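(* Let $n\ge 1$ and let $0<b\le a$. There exist constants $G_1=G_1(a,b)>0$ and $G_2=G_2(a,b)$ such that the following holds. Let $0<\mu_1\le\mu_2\le\dots\le\mu_n$ and $0<\mu_1'\le\mu_2'\le\dots\le\mu_n'$ satisfy $b\le\mu_i,\mu_i'\le a$ for every $i$, and assume that $$\frac{\sum_i\mu_i}{\mu_n}>\frac{\sum_i\mu_i'}{\mu_n'}.$$ Let $Z=\mathbb{T}^n\times\mathbb{R}$ with the metric $dt^2+\sum_i e^{2\mu_i t}dx_i^2$ and $Z'=\mathbb{T}^n\times\mathbb{R}$ with the metric $dt^2+\sum_i e^{2\mu_i' t}dx_i^2$. Then the homotopy quasi-isometric distortion growth for quasi-isometric embeddings of $B_Z(R)$ into $Z'$ satisfies $$D_{hG}(R)\ \ge\ \min\left\{G_1\left(\frac{\sum_i\mu_i}{\mu_n}-\frac{\sum_i\mu_i'}{\mu_n'}\right)R-G_2,\ \frac18R\right\}.$$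
   Context: $\mathbb{T}^n=\mathbb{R}^n/\mathbb{Z}^n$ with coordinates $x_1,\dots,x_n$ (mod 1); $t$ is the coordinate on $\mathbb{R}$. Base points: $O=(0,\dots,0)\in Z$ and $O'=(0,\dots,0)\in Z'$. $B_Z(R)=B_Z(O,R)$ is the ball of radius $R$ centred at $O$. A map $f:E\to F$ between metric spaces is a $(\lambda,c)$-quasi-isometric embedding ($\lambda>0$, $c\ge0$) if for all $x,y\in E$, $\frac1\lambda(d(x,y)-c)\le d(f(x),f(y))\le\lambda d(x,y)+c$. For metric spaces $X,Y$ with base points $x_0,y_0$, the homotopy quasi-isometric distortion growth is $$D_{hG}(X,x_0,Y,y_0)(R)=\inf\{\lambda_f+c_f\},$$ the infimum being over all maps $f:B_X(x_0,R)\to Y$ that are $(\lambda_f,c_f)$-quasi-isometric embeddings, satisfy $f(x_0)=y_0$, and are homotopy equivalences. In the claim, $D_{hG}(R)=D_{hG}(Z,O,Z',O')(R)$. The dimension $n$ is fixed throughout; constants may depend on it. *)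

theory Defs
  imports "HOL-Analysis.Analysis"
begin

definition quasi_isometric_embedding_on ::
  "'a set \<Rightarrow> ('a \<Rightarrow> 'a \<Rightarrow> real) \<Rightarrow> 'b set \<Rightarrow> ('b \<Rightarrow> 'b \<Rightarrow> real) \<Rightarrow> real \<Rightarrow> real \<Rightarrow> ('a \<Rightarrow> 'b) \<Rightarrow> bool"
  where
  "quasi_isometric_embedding_on E dE F dF \<kappa> c f \<longleftrightarrow>
     \<kappa> > 0 \<and> c \<ge> 0 \<and> f \<in> E \<rightarrow> F \<and>
     (\<forall>x\<in>E. \<forall>y\<in>E. (1 / \<kappa>) * (dE x y - c) \<le> dF (f x) (f y) \<and> dF (f x) (f y) \<le> \<kappa> * dE x y + c)"

definition homotopy_equivalence_map :: "'a topology \<Rightarrow> 'b topology \<Rightarrow> ('a \<Rightarrow> 'b) \<Rightarrow> bool" where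
  "homotopy_equivalence_map X Y f \<longleftrightarrow>
     continuous_map X Y f \<and>
     (\<exists>g. continuous_map Y X g \<and>
          homotopic_with (\<lambda>x. True) X X (g \<circ> f) id \<and>
          homotopic_with (\<lambda>x. True) Y Y (f \<circ> g) id)"

text \<open>The infimum is taken in the extended reals, so that it is \<open>\<infinity>\<close> when no admissible map exists
  (for instance when the ball is contractible and the target is not). Balls are open.\<close>

definition homotopy_qi_distortion ::
  "'a set \<Rightarrow> ('a \<Rightarrow> 'a \<Rightarrow> real) \<Rightarrow> 'a \<Rightarrow> 'b set \<Rightarrow> ('b \<Rightarrow> 'b \<Rightarrow> real) \<Rightarrow> 'b \<Rightarrow> real \<Rightarrow> ereal" where
  "homotopy_qi_distortion X dX x0 Y dY y0 R =
     Inf {ereal (\<kappa> + c) | \<kappa> c f.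
       quasi_isometric_embedding_on (Metric_space.mball X dX x0 R) dX Y dY \<kappa> c f \<and>
       f x0 = y0 \<and>
       homotopy_equivalence_map
         (subtopology (Metric_space.mtopology X dX) (Metric_space.mball X dX x0 R))
         (Metric_space.mtopology Y dY) f}"

definition lattice_rel :: "real ^ 'n \<Rightarrow> real ^ 'n \<Rightarrow> bool" where
  "lattice_rel x y \<longleftrightarrow> (\<forall>i. x $ i - y $ i \<in> \<int>)"

lemma equivp_lattice_rel: "equivp lattice_rel"
proof (rule equivpI)
  show "reflp lattice_rel"
    by (simp add: reflp_def lattice_rel_def)
  show "symp lattice_rel"
    unfolding symp_def lattice_rel_def by (metis Ints_minus minus_diff_eq)
  show "transp lattice_rel"
    unfolding transp_def lattice_rel_def
    by (metis Ints_add diff_add_cancel add_diff_eq)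
qed

quotient_type 'n torus = "real ^ 'n" / "lattice_rel :: real ^ 'n \<Rightarrow> real ^ 'n \<Rightarrow> bool"
  by (rule equivp_lattice_rel)

definition torus_proj :: "(real ^ 'n) \<times> real \<Rightarrow> 'n torus \<times> real" where
  "torus_proj p = (abs_torus (fst p), snd p)"

definition origin :: "'n::finite torus \<times> real" where
  "origin = torus_proj 0"

text \<open>Norm of the velocity of a curve in \<open>\<real>\<^sup>n \<times> \<real>\<close> for the metric
  \<open>dt\<^sup>2 + (\<Sum>i. exp (2 \<mu>\<^sub>i t) dx\<^sub>i\<^sup>2)\<close>.\<close>

definition speed :: "('n::finite \<Rightarrow> real) \<Rightarrow> (real \<Rightarrow> (real ^ 'n) \<times> real) \<Rightarrow> real \<Rightarrow> real" where
  "speed \<mu> \<gamma> s =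
     (let v = vector_derivative \<gamma> (at s)
      in sqrt ((snd v)\<^sup>2 + (\<Sum>i\<in>UNIV. exp (2 * \<mu> i * snd (\<gamma> s)) * (fst v $ i)\<^sup>2)))"

text \<open>Riemannian distance on \<open>\<real>\<^sup>n/\<int>\<^sup>n \<times> \<real>\<close>: the infimum of the lengths of piecewise \<open>C\<^sup>1\<close> curves
  joining the two points. Such curves are exactly the projections of piecewise \<open>C\<^sup>1\<close> curves in the
  covering space \<open>\<real>\<^sup>n \<times> \<real>\<close>, and the metric tensor is the one pulled back there. The library's
  \<open>valid_path\<close> allows the derivative to be unbounded near the exceptional points, so the
  length is required to exist by means of \<open>has_integral\<close>.\<close>

definition torus_dist :: "('n::finite \<Rightarrow> real) \<Rightarrow> 'n torus \<times> real \<Rightarrow> 'n torus \<times> real \<Rightarrow> real" where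
  "torus_dist \<mu> p q =
     Inf {L. \<exists>\<gamma>. valid_path \<gamma> \<and>
               torus_proj (pathstart \<gamma>) = p \<and> torus_proj (pathfinish \<gamma>) = q \<and>
               (speed \<mu> \<gamma> has_integral L) {0..1}}"

end

theory Submission
  imports Defs
begin

text \<open>
  Write \<open>\<Lambda> = \<kappa> + c\<close>, \<open>h = \<Sum>\<^sub>i \<mu>\<^sub>i\<close>, \<open>h' = \<Sum>\<^sub>i \<mu>'\<^sub>i\<close>, and let \<open>n\<close> also stand for the index of the largest weight.
  The claim is that \<open>\<Lambda>\<close> grows at least linearly in \<open>\<delta> R\<close>, where \<open>\<delta> = h / \<mu>\<^sub>n - h' / \<mu>'\<^sub>n\<close>. The proof
  compares two estimates of one sum of weights, a discrete form of the \<open>L\<^sup>p\<close> energy of a circle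
  coordinate pulled back by the embedding.

  Cut the torus at each integer height \<open>t \<ge> 0\<close> of the source into cells of unit size; there are about
  \<open>exp (h t)\<close> of them. A cell whose image lies at height \<open>\<tau>\<close> gets the weight
  \<open>w = min 1 (E exp (- \<mu>'\<^sub>n \<tau>))\<close> with \<open>E = exp (O(\<Lambda>))\<close>. Up to the factor 2 needed for the cap, this bounds
  how far the image of a unit arc can turn the coordinate \<open>x\<^sub>n\<close> of the target, because such an image has
  diameter at most \<open>\<Lambda>\<close>.

  Source side. A homotopy equivalence acts invertibly on the lattice \<open>\<int>\<^sup>n\<close> of deck transformations
  (\<open>homotopy_equivalence_lift\<close>), so some coordinate circle of the source is sent to a loop that winds
  around the \<open>n\<close>-th circle of the target, and this holds for all parallel circles at all heights.
  Hence the weights along each of these circles add up to at least 1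
  (\<open>circuit_weight_ge_1\<close>, \<open>grid_line_weight_ge_1\<close>). A circle at height \<open>t\<close> has at most \<open>2 exp (\<mu>\<^sub>n t)\<close>
  cells, so for \<open>p \<ge> 1\<close> the power mean inequality shows that \<open>w\<^sup>p\<close> sums over the slice to
  at least a constant times \<open>exp ((h - p \<mu>\<^sub>n) t)\<close> (\<open>slice_sum_lower_bound\<close>).

  Target side. By the lower quasi-isometry inequality at most \<open>exp (O(\<Lambda>))\<close> cells have their image in a
  given unit box of the target (\<open>card_close_grid_points\<close>, \<open>same_box_close\<close>). There are about \<open>exp (h' m)\<close>
  boxes at height \<open>m \<ge> 0\<close> and a single one at each height \<open>m < 0\<close>. For the critical exponent
  \<open>p = h' / \<mu>'\<^sub>n\<close>, which lies between 1 and the dimension, the factor \<open>exp (h' m)\<close> is cancelled by the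
  weights \<open>exp (- p \<mu>'\<^sub>n m)\<close>, and every level contributes at most \<open>exp (O(\<Lambda>))\<close>. The image of the ball
  meets \<open>O(\<Lambda> R)\<close> levels (\<open>weight_sum_upper_bound\<close>).

  With this exponent \<open>h - p \<mu>\<^sub>n = \<mu>\<^sub>n \<delta> \<ge> b \<delta>\<close>. The ball contains the slices up to a height of the
  order of \<open>R\<close>, so the source side is at least a multiple of \<open>R exp (b \<delta> R / 4)\<close>
  (\<open>exp_sum_ge_midpoint\<close>) and the target side is at most \<open>R exp (O(\<Lambda>))\<close>. The two factors \<open>R\<close> cancel,
  and taking logarithms gives the linear bound.
\<close>

section \<open>Lengths of curves in the covering space\<close>

lemma torus_proj_eq_iff:
  fixes p q :: "(real ^ 'n) \<times> real"
  shows "torus_proj p = torus_proj q \<longleftrightarrow> (\<forall>i. fst p $ i - fst q $ i \<in> \<int>) \<and> snd p = snd q"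
  by (auto simp: torus_proj_def torus.abs_eq_iff lattice_rel_def)

lemma torus_proj_surj: "\<exists>p. torus_proj p = q"
proof -
  obtain y s where q: "q = (y, s)" by (cases q)
  have "abs_torus (rep_torus y) = y"
    by (meson Quotient_abs_rep Quotient_torus)
  then have "torus_proj (rep_torus y, s) = q"
    by (simp add: torus_proj_def q)
  then show ?thesis ..
qed

lemma snd_torus_proj [simp]: "snd (torus_proj p) = snd p"
  by (simp add: torus_proj_def)

lemma speed_nonneg: "0 \<le> speed \<mu> \<gamma> s"
  by (simp add: speed_def Let_def sum_nonneg)

lemma abs_snd_le_speed: "\<bar>snd (vector_derivative \<gamma> (at s))\<bar> \<le> speed \<mu> \<gamma> s"
  unfolding speed_def Let_def
  by (rule real_le_rsqrt) (simp add: sum_nonneg)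

lemma abs_fst_le_speed:
  "exp (\<mu> i * snd (\<gamma> s)) * \<bar>fst (vector_derivative \<gamma> (at s)) $ i\<bar> \<le> speed \<mu> \<gamma> s"
proof -
  let ?v = "vector_derivative \<gamma> (at s)"
  have "(exp (\<mu> i * snd (\<gamma> s)) * \<bar>fst ?v $ i\<bar>)\<^sup>2 = exp (2 * \<mu> i * snd (\<gamma> s)) * (fst ?v $ i)\<^sup>2"
    by (simp add: power_mult_distrib mult.assoc exp_double)
  also have "\<dots> \<le> (\<Sum>i\<in>UNIV. exp (2 * \<mu> i * snd (\<gamma> s)) * (fst ?v $ i)\<^sup>2)"
    by (rule member_le_sum[where f = "\<lambda>i. exp (2 * \<mu> i * snd (\<gamma> s)) * (fst ?v $ i)\<^sup>2"]) auto
  also have "\<dots> \<le> (snd ?v)\<^sup>2 + (\<Sum>i\<in>UNIV. exp (2 * \<mu> i * snd (\<gamma> s)) * (fst ?v $ i)\<^sup>2)"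
    by simp
  finally show ?thesis
    unfolding speed_def Let_def by (rule real_le_rsqrt)
qed

lemma speed_le_sum:
  "speed \<mu> \<gamma> s \<le> \<bar>snd (vector_derivative \<gamma> (at s))\<bar>
     + (\<Sum>i\<in>UNIV. exp (\<mu> i * snd (\<gamma> s)) * \<bar>fst (vector_derivative \<gamma> (at s)) $ i\<bar>)"
proof -
  let ?v = "vector_derivative \<gamma> (at s)"
  let ?w = "\<lambda>i. exp (\<mu> i * snd (\<gamma> s)) * \<bar>fst ?v $ i\<bar>"
  have sq: "exp (2 * \<mu> i * snd (\<gamma> s)) * (fst ?v $ i)\<^sup>2 = (?w i)\<^sup>2" for i
    by (simp add: power_mult_distrib mult.assoc exp_double)
  have "speed \<mu> \<gamma> s \<le> sqrt ((snd ?v)\<^sup>2) + sqrt (\<Sum>i\<in>UNIV. (?w i)\<^sup>2)"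
    unfolding speed_def Let_def sq by (rule sqrt_add_le_add_sqrt) (auto intro: sum_nonneg)
  also have "sqrt (\<Sum>i\<in>UNIV. (?w i)\<^sup>2) \<le> (\<Sum>i\<in>UNIV. ?w i)"
    using L2_set_le_sum[of UNIV ?w] by (simp add: L2_set_def)
  finally show ?thesis by simp
qed

lemma valid_path_exceptional_set:
  assumes "valid_path \<gamma>"
  obtains S where "finite S"
    "\<And>s. s \<in> {0..1} - S \<Longrightarrow> (\<gamma> has_vector_derivative vector_derivative \<gamma> (at s)) (at s)"
  using assms unfolding valid_path_def piecewise_C1_differentiable_on_def C1_differentiable_on_eq
  by (metis vector_derivative_works)

lemma valid_path_has_integral_derivative:
  fixes \<gamma> :: "real \<Rightarrow> 'a::banach"
  assumes "valid_path \<gamma>" "0 \<le> s" "s \<le> 1"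
  shows "((\<lambda>u. vector_derivative \<gamma> (at u)) has_integral (\<gamma> s - \<gamma> 0)) {0..s}"
proof -
  obtain S where S: "finite S"
    "\<And>s. s \<in> {0..1} - S \<Longrightarrow> (\<gamma> has_vector_derivative vector_derivative \<gamma> (at s)) (at s)"
    using valid_path_exceptional_set[OF assms(1)] by blast
  have "continuous_on {0..1} \<gamma>"
    using assms(1) by (simp add: valid_path_def piecewise_C1_differentiable_on_def)
  then have "continuous_on {0..s} \<gamma>"
    by (rule continuous_on_subset) (use assms in auto)
  with S(2) assms show ?thesis
    by (intro fundamental_theorem_of_calculus_interior_strong[OF S(1)]) auto
qed

text \<open>A curve of length \<open>L\<close> never leaves the heights above \<open>snd (\<gamma> 0) - L\<close>, where moving in direction \<open>i\<close> costs
at least the factor \<open>exp (\<mu> i * (snd (\<gamma> 0) - L))\<close>. This is all that is used of the Riemannian metric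
from below.\<close>

lemma curve_displacement:
  fixes \<gamma> :: "real \<Rightarrow> (real ^ 'n) \<times> real"
  assumes "valid_path \<gamma>" and L: "(speed \<mu> \<gamma> has_integral L) {0..1}" and "\<mu> i \<ge> 0"
  shows "\<bar>snd (\<gamma> 1) - snd (\<gamma> 0)\<bar> \<le> L"
    and "\<bar>fst (\<gamma> 1) $ i - fst (\<gamma> 0) $ i\<bar> \<le> L * exp (\<mu> i * (L - snd (\<gamma> 0)))"
proof -
  let ?v = "\<lambda>u. vector_derivative \<gamma> (at u)"
  have height: "\<bar>snd (\<gamma> s) - snd (\<gamma> 0)\<bar> \<le> L" if s: "s \<in> {0..1}" for s
  proof -
    have "(?v has_integral (\<gamma> s - \<gamma> 0)) {0..s}"
      using valid_path_has_integral_derivative[OF assms(1)] s by simp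
    from has_integral_linear[OF this bounded_linear_snd]
    have D: "((\<lambda>u. snd (?v u)) has_integral (snd (\<gamma> s) - snd (\<gamma> 0))) {0..s}"
      by (simp add: o_def)
    have int: "speed \<mu> \<gamma> integrable_on {0..s}"
      using integrable_subinterval_real[OF has_integral_integrable[OF L]] s by auto
    have "norm (integral {0..s} (\<lambda>u. snd (?v u))) \<le> integral {0..s} (speed \<mu> \<gamma>)"
      by (rule integral_norm_bound_integral)
        (use D int abs_snd_le_speed[of \<gamma> _ \<mu>] in \<open>auto simp: has_integral_integrable\<close>)
    also have "\<dots> \<le> integral {0..1} (speed \<mu> \<gamma>)"
      by (rule integral_subset_le)
        (use int s has_integral_integrable[OF L] in \<open>auto simp: speed_nonneg\<close>)
    finally show ?thesis
      using integral_unique[OF D] integral_unique[OF L] by simp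
  qed
  from height[of 1] show "\<bar>snd (\<gamma> 1) - snd (\<gamma> 0)\<bar> \<le> L" by simp
  have "(?v has_integral (\<gamma> 1 - \<gamma> 0)) {0..1}"
    using valid_path_has_integral_derivative[OF assms(1), of 1] by simp
  from has_integral_linear[OF this bounded_linear_compose[OF bounded_linear_vec_nth[of i] bounded_linear_fst]]
  have D: "((\<lambda>u. fst (?v u) $ i) has_integral (fst (\<gamma> 1) $ i - fst (\<gamma> 0) $ i)) {0..1}"
    by (simp add: o_def)
  have E: "((\<lambda>u. exp (\<mu> i * (L - snd (\<gamma> 0))) * speed \<mu> \<gamma> u) has_integral
      (exp (\<mu> i * (L - snd (\<gamma> 0))) * L)) {0..1}"
    by (rule has_integral_mult_right[OF L])
  have "norm (integral {0..1} (\<lambda>u. fst (?v u) $ i))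
      \<le> integral {0..1} (\<lambda>u. exp (\<mu> i * (L - snd (\<gamma> 0))) * speed \<mu> \<gamma> u)"
  proof (rule integral_norm_bound_integral)
    fix u :: real assume u: "u \<in> {0..1}"
    \<comment> \<open>The curve stays above height \<open>snd (\<gamma> 0) - L\<close>.\<close>
    have "1 \<le> exp (\<mu> i * (L - snd (\<gamma> 0))) * exp (\<mu> i * snd (\<gamma> u))"
      using height[OF u] \<open>\<mu> i \<ge> 0\<close> unfolding exp_add[symmetric] distrib_left[symmetric]
      by (auto intro!: mult_nonneg_nonneg simp: one_le_exp_iff)
    then have "\<bar>fst (?v u) $ i\<bar>
        \<le> exp (\<mu> i * (L - snd (\<gamma> 0))) * exp (\<mu> i * snd (\<gamma> u)) * \<bar>fst (?v u) $ i\<bar>"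
      using mult_right_mono[of 1 _ "\<bar>fst (?v u) $ i\<bar>"] by fastforce
    also have "\<dots> \<le> exp (\<mu> i * (L - snd (\<gamma> 0))) * speed \<mu> \<gamma> u"
      using abs_fst_le_speed[of \<mu> i \<gamma> u] by (simp add: mult.assoc)
    finally show "norm (fst (?v u) $ i) \<le> exp (\<mu> i * (L - snd (\<gamma> 0))) * speed \<mu> \<gamma> u"
      by simp
  qed (use D E in \<open>auto simp: has_integral_integrable\<close>)
  then show "\<bar>fst (\<gamma> 1) $ i - fst (\<gamma> 0) $ i\<bar> \<le> L * exp (\<mu> i * (L - snd (\<gamma> 0)))"
    using integral_unique[OF D] integral_unique[OF E] by (simp add: mult.commute)
qed

text \<open>All curves are kept in the covering space, where the metric is explicit; the lattice enters only through
the choice of the lifts of the end points.\<close>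

definition joined_by_length ::
  "('n::finite \<Rightarrow> real) \<Rightarrow> (real ^ 'n) \<times> real \<Rightarrow> (real ^ 'n) \<times> real \<Rightarrow> real \<Rightarrow> bool" where
  "joined_by_length \<mu> p q L \<longleftrightarrow>
     (\<exists>\<gamma>. valid_path \<gamma> \<and> pathstart \<gamma> = p \<and> pathfinish \<gamma> = q \<and> (speed \<mu> \<gamma> has_integral L) {0..1})"

lemma joined_by_length_nonneg: "joined_by_length \<mu> p q L \<Longrightarrow> 0 \<le> L"
  unfolding joined_by_length_def using has_integral_nonneg speed_nonneg by metis

lemma joined_by_length_displacement:
  assumes "joined_by_length \<mu> p q L" "\<mu> i \<ge> 0"
  shows "\<bar>snd q - snd p\<bar> \<le> L"
    and "\<bar>fst q $ i - fst p $ i\<bar> \<le> L * exp (\<mu> i * (L - snd p))"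
  using assms curve_displacement[of _ \<mu> L i]
  unfolding joined_by_length_def pathstart_def pathfinish_def by blast+

text \<open>The straight segment is usually far from being a geodesic, but for points at unit scale, and for purely
vertical segments, its length has the right order.\<close>

lemma joined_by_length_line:
  assumes "\<forall>i. \<mu> i \<ge> 0" "snd p \<le> T" "snd q \<le> T"
  obtains L where "joined_by_length \<mu> p q L"
    "L \<le> \<bar>snd q - snd p\<bar> + (\<Sum>i\<in>UNIV. exp (\<mu> i * T) * \<bar>fst q $ i - fst p $ i\<bar>)"
proof -
  let ?B = "\<bar>snd q - snd p\<bar> + (\<Sum>i\<in>UNIV. exp (\<mu> i * T) * \<bar>fst q $ i - fst p $ i\<bar>)"
  let ?\<gamma> = "linepath p q"
  have "continuous_on {0..1} (speed \<mu> ?\<gamma>)"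
    unfolding speed_def Let_def linepath_def[abs_def] vector_derivative_linepath_at[unfolded linepath_def[abs_def]]
    by (intro continuous_intros)
  then have int: "speed \<mu> ?\<gamma> integrable_on {0..1}"
    by (rule integrable_continuous_real)
  have "integral {0..1} (speed \<mu> ?\<gamma>) \<le> integral {0..1} (\<lambda>_::real. ?B)"
  proof (rule integral_le[OF int])
    fix s :: real assume s: "s \<in> {0..1}"
    have "snd (?\<gamma> s) \<le> (1 - s) * T + s * T"
      using assms s by (auto simp: linepath_def intro!: add_mono mult_left_mono)
    then have h: "snd (?\<gamma> s) \<le> T" by (simp add: algebra_simps)
    have "speed \<mu> ?\<gamma> s \<le> \<bar>snd q - snd p\<bar> + (\<Sum>i\<in>UNIV. exp (\<mu> i * snd (?\<gamma> s)) * \<bar>fst q $ i - fst p $ i\<bar>)"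
      using speed_le_sum[of \<mu> ?\<gamma> s] by simp
    also have "\<dots> \<le> ?B"
      using h assms(1) by (intro add_left_mono sum_mono mult_right_mono) (auto intro: mult_left_mono)
    finally show "speed \<mu> ?\<gamma> s \<le> ?B" .
  qed auto
  then have "integral {0..1} (speed \<mu> ?\<gamma>) \<le> ?B" by simp
  moreover have "joined_by_length \<mu> p q (integral {0..1} (speed \<mu> ?\<gamma>))"
    unfolding joined_by_length_def using int
    by (intro exI[of _ ?\<gamma>]) (auto simp: integrable_integral)
  ultimately show ?thesis using that by blast
qed

lemma joined_by_length_sym:
  assumes "joined_by_length \<mu> p q L"
  shows "joined_by_length \<mu> q p L"
proof -
  obtain \<gamma> where \<gamma>: "valid_path \<gamma>" "pathstart \<gamma> = p" "pathfinish \<gamma> = q"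
    "(speed \<mu> \<gamma> has_integral L) {0..1}"
    using assms unfolding joined_by_length_def by blast
  obtain S where S: "finite S"
    "\<And>s. s \<in> {0..1} - S \<Longrightarrow> (\<gamma> has_vector_derivative vector_derivative \<gamma> (at s)) (at s)"
    using valid_path_exceptional_set[OF \<gamma>(1)] by blast
  have vd: "vector_derivative (reversepath \<gamma>) (at s) = - vector_derivative \<gamma> (at (1 - s))"
    if "s \<in> {0..1} - (\<lambda>x. 1 - x) ` S" for s
  proof (rule vector_derivative_at)
    have "1 - s \<in> {0..1} - S" using that by force
    note S(2)[OF this]
    moreover have "((\<lambda>s. 1 - s) has_vector_derivative (-1)) (at s)"
      by (auto intro!: derivative_eq_intros)
    ultimately have "(\<gamma> \<circ> (\<lambda>s. 1 - s) has_vector_derivative (-1) *\<^sub>R vector_derivative \<gamma> (at (1 - s))) (at s)"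
      by (intro vector_diff_chain_at)
    then show "(reversepath \<gamma> has_vector_derivative - vector_derivative \<gamma> (at (1 - s))) (at s)"
      by (simp add: reversepath_def o_def)
  qed
  have "((\<lambda>s. speed \<mu> \<gamma> (1 - s)) has_integral L) {0..1}"
    using has_integral_affinity[of "speed \<mu> \<gamma>" L 0 1 "-1" 1] \<gamma>(4) by simp
  then have "(speed \<mu> (reversepath \<gamma>) has_integral L) {0..1}"
  proof (rule has_integral_spike_finite[rotated 2])
    show "finite ((\<lambda>x. 1 - x) ` S)" using S by simp
  next
    fix x :: real assume x: "x \<in> {0..1} - (\<lambda>x. 1 - x) ` S"
    have "reversepath \<gamma> x = \<gamma> (1 - x)" by (simp add: reversepath_def)
    with vd[OF x] show "speed \<mu> (reversepath \<gamma>) x = speed \<mu> \<gamma> (1 - x)"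
      by (simp add: speed_def Let_def)
  qed
  moreover have "valid_path (reversepath \<gamma>)"
    using \<gamma>(1) by (rule valid_path_imp_reverse)
  ultimately show ?thesis
    unfolding joined_by_length_def using \<gamma> by (intro exI[of _ "reversepath \<gamma>"]) auto
qed

lemma joined_by_length_trans:
  assumes "joined_by_length \<mu> p q L1" "joined_by_length \<mu> q r L2"
  shows "joined_by_length \<mu> p r (L1 + L2)"
proof -
  obtain g where g: "valid_path g" "pathstart g = p" "pathfinish g = q"
    "(speed \<mu> g has_integral L1) {0..1}"
    using assms unfolding joined_by_length_def by blast
  obtain h where h: "valid_path h" "pathstart h = q" "pathfinish h = r"
    "(speed \<mu> h has_integral L2) {0..1}"
    using assms unfolding joined_by_length_def by blast
  obtain S where S: "finite S"
    "\<And>s. s \<in> {0..1} - S \<Longrightarrow> (g has_vector_derivative vector_derivative g (at s)) (at s)"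
    using valid_path_exceptional_set[OF g(1)] by blast
  obtain T where T: "finite T"
    "\<And>s. s \<in> {0..1} - T \<Longrightarrow> (h has_vector_derivative vector_derivative h (at s)) (at s)"
    using valid_path_exceptional_set[OF h(1)] by blast
  let ?j = "g +++ h"
  have vg: "vector_derivative ?j (at z) = 2 *\<^sub>R vector_derivative g (at (2 * z))"
    if "0 \<le> z" "2 * z < 1" "2 * z \<notin> S" for z
  proof (rule vector_derivative_at [OF has_vector_derivative_transform_within])
    show "0 < 1/2 - z" using that by auto
    have "((*) 2 has_vector_derivative 2) (at z)"
      by (simp add: has_vector_derivative_def has_derivative_def bounded_linear_mult_left)
    moreover have "(g has_vector_derivative vector_derivative g (at (2 * z))) (at (2 * z))"
      using S that by auto
    ultimately show "((\<lambda>x. g (2 * x)) has_vector_derivative 2 *\<^sub>R vector_derivative g (at (2 * z))) (at z)"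
      by (intro vector_diff_chain_at [simplified o_def])
  qed (use that in \<open>auto simp: joinpaths_def dist_real_def abs_if split: if_split_asm\<close>)
  have vh: "vector_derivative ?j (at z) = 2 *\<^sub>R vector_derivative h (at (2 * z - 1))"
    if "1 < 2 * z" "z \<le> 1" "2 * z - 1 \<notin> T" for z
  proof (rule vector_derivative_at [OF has_vector_derivative_transform_within])
    show "0 < z - 1/2" using that by auto
    have "((\<lambda>x. 2 * x - 1) has_vector_derivative 2) (at z)"
      by (simp add: has_vector_derivative_def has_derivative_def bounded_linear_mult_left)
    moreover have "(h has_vector_derivative vector_derivative h (at (2 * z - 1))) (at (2 * z - 1))"
      using T that by auto
    ultimately show "((\<lambda>x. h (2 * x - 1)) has_vector_derivative 2 *\<^sub>R vector_derivative h (at (2 * z - 1))) (at z)"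
      by (intro vector_diff_chain_at [simplified o_def])
  qed (use that in \<open>auto simp: joinpaths_def dist_real_def abs_if split: if_split_asm\<close>)
  have scale: "sqrt (4 * x\<^sup>2 + (\<Sum>i\<in>UNIV. c i * (4 * (y i)\<^sup>2))) = 2 * sqrt (x\<^sup>2 + (\<Sum>i\<in>UNIV. c i * (y i)\<^sup>2))"
    for x :: real and c y :: "'a \<Rightarrow> real"
  proof -
    have "4 * x\<^sup>2 + (\<Sum>i\<in>UNIV. c i * (4 * (y i)\<^sup>2)) = 4 * (x\<^sup>2 + (\<Sum>i\<in>UNIV. c i * (y i)\<^sup>2))"
      by (simp add: sum_distrib_left algebra_simps)
    then show ?thesis by (simp only: real_sqrt_mult) simp
  qed
  have "((\<lambda>x. 2 * speed \<mu> g (2 * x)) has_integral L1) {0..1/2}"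
    using has_integral_mult_right[OF has_integral_affinity'[of "speed \<mu> g" L1 0 1 2 0], of 2] g(4)
    by simp
  then have 1: "(speed \<mu> ?j has_integral L1) {0..1/2}"
  proof (rule has_integral_spike_finite[rotated 2])
    show "finite (insert (1/2) ((*) 2 -` S))"
      using S by (force intro: finite_vimageI [where h = "(*)2"] inj_onI)
  next
    fix x :: real assume x: "x \<in> {0..1/2} - insert (1/2) ((*) 2 -` S)"
    then have "?j x = g (2 * x)" by (auto simp: joinpaths_def)
    with x show "speed \<mu> ?j x = 2 * speed \<mu> g (2 * x)"
      by (simp add: speed_def vg Let_def scale power_mult_distrib)
  qed
  have "((\<lambda>x. 2 * speed \<mu> h (2 * x - 1)) has_integral L2) {1/2..1}"
    using has_integral_mult_right[OF has_integral_affinity'[of "speed \<mu> h" L2 0 1 2 "-1"], of 2] h(4)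
    by simp
  then have 2: "(speed \<mu> ?j has_integral L2) {1/2..1}"
  proof (rule has_integral_spike_finite[rotated 2])
    show "finite (insert (1/2) ((\<lambda>x. 2 * x - 1) -` T))"
      using T by (force intro: finite_vimageI [where h = "\<lambda>x. 2*x-1"] inj_onI)
  next
    fix x :: real assume x: "x \<in> {1/2..1} - insert (1/2) ((\<lambda>x. 2 * x - 1) -` T)"
    then have "?j x = h (2 * x - 1)" by (auto simp: joinpaths_def)
    with x show "speed \<mu> ?j x = 2 * speed \<mu> h (2 * x - 1)"
      by (simp add: speed_def vh Let_def scale power_mult_distrib)
  qed
  have "(speed \<mu> ?j has_integral (L1 + L2)) {0..1}"
    by (rule has_integral_combine[OF _ _ 1 2]) auto
  moreover have "valid_path ?j"
    using g h by (intro valid_path_join) auto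
  ultimately show ?thesis
    unfolding joined_by_length_def using g h by (intro exI[of _ ?j]) auto
qed

lemma joined_by_length_translate:
  assumes "joined_by_length \<mu> p q L"
  shows "joined_by_length \<mu> (p + (v, 0)) (q + (v, 0)) L"
proof -
  obtain g where g: "valid_path g" "pathstart g = p" "pathfinish g = q"
    "(speed \<mu> g has_integral L) {0..1}"
    using assms unfolding joined_by_length_def by blast
  let ?h = "\<lambda>s. g s + (v, 0)"
  have "vector_derivative ?h (at s) = vector_derivative g (at s)" for s
    by (simp add: vector_derivative_def has_vector_derivative_add_const)
  then have "speed \<mu> ?h = speed \<mu> g"
    by (simp add: speed_def fun_eq_iff)
  moreover have "valid_path ?h"
    using g(1) unfolding valid_path_def
    by (rule piecewise_C1_differentiable_add) (auto intro: C1_differentiable_imp_piecewise)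
  ultimately show ?thesis
    unfolding joined_by_length_def using g
    by (intro exI[of _ ?h]) (auto simp: pathstart_def pathfinish_def)
qed

section \<open>The torus with exponentially growing metric\<close>

definition integer_vec :: "real ^ 'n \<Rightarrow> bool" where
  "integer_vec v \<longleftrightarrow> (\<forall>i. v $ i \<in> \<int>)"

lemma torus_proj_eq_translate_iff:
  fixes p q :: "(real ^ 'n) \<times> real"
  shows "torus_proj p = torus_proj q \<longleftrightarrow> (\<exists>v. integer_vec v \<and> q = p + (v, 0))"
proof
  assume "torus_proj p = torus_proj q"
  then have "(\<forall>i. fst q $ i - fst p $ i \<in> \<int>) \<and> snd p = snd q"
    by (metis torus_proj_eq_iff)
  then have "integer_vec (fst q - fst p)" "q = p + (fst q - fst p, 0)"
    by (auto simp: integer_vec_def prod_eq_iff)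
  then show "\<exists>v. integer_vec v \<and> q = p + (v, 0)" by blast
qed (auto simp: torus_proj_eq_iff integer_vec_def)

lemma torus_proj_translate: "integer_vec v \<Longrightarrow> torus_proj (p + (v, 0)) = torus_proj p"
  by (metis torus_proj_eq_translate_iff)

lemma torus_dist_alt:
  "torus_dist \<mu> p q =
     Inf {L. \<exists>x y. torus_proj x = p \<and> torus_proj y = q \<and> joined_by_length \<mu> x y L}"
  unfolding torus_dist_def joined_by_length_def
  by (rule arg_cong[where f = Inf]) blast

lemma torus_dist_le:
  assumes "joined_by_length \<mu> x y L"
  shows "torus_dist \<mu> (torus_proj x) (torus_proj y) \<le> L"
  unfolding torus_dist_alt
proof (rule cInf_lower)
  show "bdd_below {L. \<exists>x' y'. torus_proj x' = torus_proj x \<and> torus_proj y' = torus_proj y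
      \<and> joined_by_length \<mu> x' y' L}"
    by (rule bdd_belowI[of _ 0]) (auto dest: joined_by_length_nonneg)
qed (use assms in blast)

lemma torus_dist_lessD:
  assumes "\<forall>i. \<mu> i \<ge> 0" "torus_dist \<mu> (torus_proj x) (torus_proj y) < L"
  obtains v L' where "integer_vec v" "L' < L" "joined_by_length \<mu> x (y + (v, 0)) L'"
proof -
  obtain L0 where "joined_by_length \<mu> x y L0"
    using joined_by_length_line[OF assms(1), of x "max (snd x) (snd y)" y] by auto
  then have "{L. \<exists>x' y'. torus_proj x' = torus_proj x \<and> torus_proj y' = torus_proj y
      \<and> joined_by_length \<mu> x' y' L} \<noteq> {}" by blast
  from cInf_lessD[OF this assms(2)[unfolded torus_dist_alt]]
  obtain L' x' y' where L': "L' < L" "torus_proj x' = torus_proj x"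
    "torus_proj y' = torus_proj y" "joined_by_length \<mu> x' y' L'" by blast
  obtain u where u: "integer_vec u" "x = x' + (u, 0)" using L'(2) torus_proj_eq_translate_iff by blast
  obtain w where w: "integer_vec w" "y' = y + (w, 0)" using L'(3) torus_proj_eq_translate_iff by metis
  have "y' + (u, 0) = y + (w + u, 0)" by (simp add: w prod_eq_iff)
  then have "joined_by_length \<mu> x (y + (w + u, 0)) L'"
    using joined_by_length_translate[OF L'(4), of u] u by simp
  moreover have "integer_vec (w + u)" using u w by (simp add: integer_vec_def)
  ultimately show ?thesis using L'(1) that by blast
qed

text \<open>The converse of the straight-line estimate: nearby points have lifts that are close in every coordinate,
with an error that is governed by the height of the first point.\<close>

lemma torus_dist_displacement:
  assumes "\<forall>i. \<mu> i \<ge> 0" "torus_dist \<mu> (torus_proj p) (torus_proj q) < L"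
  obtains v where "integer_vec v" "\<bar>snd q - snd p\<bar> \<le> L"
    "\<And>i. \<bar>fst q $ i + v $ i - fst p $ i\<bar> \<le> L * exp (\<mu> i * (L - snd p))"
proof -
  obtain v L' where v: "integer_vec v" "L' < L" "joined_by_length \<mu> p (q + (v, 0)) L'"
    using torus_dist_lessD[OF assms] by blast
  have "0 \<le> L'" using joined_by_length_nonneg v by blast
  have "\<bar>snd q - snd p\<bar> \<le> L"
    using joined_by_length_displacement(1)[OF v(3) assms(1)[rule_format]] v(2) by simp
  moreover have "\<bar>fst q $ i + v $ i - fst p $ i\<bar> \<le> L * exp (\<mu> i * (L - snd p))" for i
  proof -
    have "\<bar>fst q $ i + v $ i - fst p $ i\<bar> \<le> L' * exp (\<mu> i * (L' - snd p))"
      using joined_by_length_displacement(2)[OF v(3) assms(1)[rule_format, of i]] by simp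
    also have "\<dots> \<le> L * exp (\<mu> i * (L - snd p))"
      using v(2) \<open>0 \<le> L'\<close> assms(1)[rule_format, of i] by (intro mult_mono) (auto intro: mult_left_mono)
    finally show ?thesis .
  qed
  ultimately show ?thesis using that v(1) by blast
qed

lemma torus_dist_le_line:
  assumes "\<forall>i. \<mu> i \<ge> 0" "snd p \<le> T" "snd q \<le> T"
  shows "torus_dist \<mu> (torus_proj p) (torus_proj q)
    \<le> \<bar>snd q - snd p\<bar> + (\<Sum>i\<in>UNIV. exp (\<mu> i * T) * \<bar>fst q $ i - fst p $ i\<bar>)"
proof -
  obtain L where "joined_by_length \<mu> p q L"
    "L \<le> \<bar>snd q - snd p\<bar> + (\<Sum>i\<in>UNIV. exp (\<mu> i * T) * \<bar>fst q $ i - fst p $ i\<bar>)"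
    by (rule joined_by_length_line[OF assms])
  with torus_dist_le show ?thesis by (meson order_trans)
qed

lemma torus_dist_nonneg:
  assumes "\<forall>i. \<mu> i \<ge> 0"
  shows "0 \<le> torus_dist \<mu> p q"
proof (rule ccontr)
  assume "\<not> 0 \<le> torus_dist \<mu> p q"
  moreover obtain x y where "p = torus_proj x" "q = torus_proj y" by (metis torus_proj_surj)
  ultimately have "torus_dist \<mu> (torus_proj x) (torus_proj y) < 0" by simp
  then obtain v L' where "L' < 0" "joined_by_length \<mu> x (y + (v, 0)) L'"
    by (rule torus_dist_lessD[OF assms])
  then show False using joined_by_length_nonneg by (meson not_less)
qed

lemma torus_dist_triangle:
  assumes "\<forall>i. \<mu> i \<ge> 0"
  shows "torus_dist \<mu> p r \<le> torus_dist \<mu> p q + torus_dist \<mu> q r"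
proof (rule field_le_epsilon)
  fix e :: real assume "0 < e"
  obtain x y z where xyz: "p = torus_proj x" "q = torus_proj y" "r = torus_proj z"
    by (metis torus_proj_surj)
  obtain v L1 where 1: "integer_vec v" "L1 < torus_dist \<mu> p q + e / 2"
    "joined_by_length \<mu> x (y + (v, 0)) L1"
    using torus_dist_lessD[OF assms, of x y "torus_dist \<mu> p q + e / 2"] \<open>0 < e\<close> xyz by auto
  have "torus_proj (y + (v, 0)) = q" using torus_proj_translate 1 xyz by simp
  then obtain w L2 where 2: "integer_vec w" "L2 < torus_dist \<mu> q r + e / 2"
    "joined_by_length \<mu> (y + (v, 0)) (z + (w, 0)) L2"
    using torus_dist_lessD[OF assms, of "y + (v, 0)" z "torus_dist \<mu> q r + e / 2"] \<open>0 < e\<close> xyz by auto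
  have "torus_dist \<mu> p r \<le> L1 + L2"
    using torus_dist_le[OF joined_by_length_trans[OF 1(3) 2(3)]] torus_proj_translate[OF 2(1)] xyz
    by simp
  with 1 2 show "torus_dist \<mu> p r \<le> torus_dist \<mu> p q + torus_dist \<mu> q r + e" by simp
qed

lemma torus_dist_commute: "torus_dist \<mu> p q = torus_dist \<mu> q p"
  unfolding torus_dist_alt
  by (rule arg_cong[where f = Inf]) (use joined_by_length_sym in blast)

lemma torus_dist_self:
  assumes "\<forall>i. \<mu> i \<ge> 0"
  shows "torus_dist \<mu> p p = 0"
proof -
  obtain x where x: "p = torus_proj x" by (metis torus_proj_surj)
  have "torus_dist \<mu> p p \<le> 0"
    using torus_dist_le_line[OF assms, of x "snd x" x] x by simp
  with torus_dist_nonneg[OF assms, of p p] show ?thesis by simp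
qed

text \<open>At a fixed point the displacement estimate gives arbitrary precision; this yields both the separation
axiom for the distance and the continuity of the circle coordinates.\<close>

lemma torus_dist_small_displacement:
  assumes "\<forall>i. \<mu> i \<ge> 0" "e > 0"
  obtains r where "r > 0"
    "\<forall>q. torus_dist \<mu> (torus_proj p) (torus_proj q) < r \<longrightarrow> (\<exists>m\<in>\<int>. \<bar>fst q $ i + m - fst p $ i\<bar> < e)"
proof -
  let ?c = "exp (\<mu> i * (1 - snd p))"
  define r where "r = min 1 (e / (2 * ?c))"
  have "r > 0" "r \<le> 1" using \<open>e > 0\<close> by (auto simp: r_def)
  have "r * ?c \<le> e / (2 * ?c) * ?c" by (intro mult_right_mono) (auto simp: r_def)
  with \<open>e > 0\<close> have "r * ?c < e" by simp
  have "\<exists>m\<in>\<int>. \<bar>fst q $ i + m - fst p $ i\<bar> < e"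
    if d: "torus_dist \<mu> (torus_proj p) (torus_proj q) < r" for q
  proof -
    obtain v where v: "integer_vec v"
      "\<And>i. \<bar>fst q $ i + v $ i - fst p $ i\<bar> \<le> r * exp (\<mu> i * (r - snd p))"
      using torus_dist_displacement[OF assms(1) d] by blast
    have "r * exp (\<mu> i * (r - snd p)) \<le> r * ?c"
      using \<open>r > 0\<close> \<open>r \<le> 1\<close> assms(1) by (auto intro!: mult_left_mono)
    with v \<open>r * ?c < e\<close> show ?thesis
      unfolding integer_vec_def by (meson order_le_less_trans order_trans)
  qed
  with \<open>r > 0\<close> show ?thesis using that by blast
qed

lemma torus_dist_eq_0D:
  assumes "\<forall>i. \<mu> i \<ge> 0" "torus_dist \<mu> p q = 0"
  shows "p = q"
proof -
  obtain x y where xy: "p = torus_proj x" "q = torus_proj y" by (metis torus_proj_surj)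
  have *: "torus_dist \<mu> (torus_proj x) (torus_proj y) < e" if "e > 0" for e
    using assms(2) xy that by simp
  have "\<bar>snd y - snd x\<bar> \<le> e" if "e > 0" for e
    by (rule torus_dist_displacement[OF assms(1) *[OF that]])
  then have "\<bar>snd y - snd x\<bar> \<le> 0" by (rule dense_ge)
  then have "snd x = snd y" by simp
  moreover have "fst x $ i - fst y $ i \<in> \<int>" for i
  proof -
    have "\<exists>m\<in>\<int>. dist m (fst x $ i - fst y $ i) < e" if e: "e > 0" for e
    proof -
      obtain r where "r > 0" "\<forall>q. torus_dist \<mu> (torus_proj x) (torus_proj q) < r \<longrightarrow>
          (\<exists>m\<in>\<int>. \<bar>fst q $ i + m - fst x $ i\<bar> < e)"
        by (rule torus_dist_small_displacement[OF assms(1) e, of x i])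
      with * obtain m where "m \<in> \<int>" "\<bar>fst y $ i + m - fst x $ i\<bar> < e" by blast
      then show ?thesis by (intro bexI[of _ m]) (auto simp: dist_real_def algebra_simps)
    qed
    then show ?thesis
      using closed_approachable[of \<int> "fst x $ i - fst y $ i"] closed_Ints by blast
  qed
  ultimately show ?thesis using xy torus_proj_eq_iff by blast
qed

lemma Metric_space_torus:
  assumes "\<forall>i. \<mu> i \<ge> 0"
  shows "Metric_space UNIV (torus_dist \<mu>)"
proof
  fix p q r :: "'a torus \<times> real"
  show "0 \<le> torus_dist \<mu> p q" by (rule torus_dist_nonneg[OF assms])
  show "torus_dist \<mu> p q = torus_dist \<mu> q p" by (rule torus_dist_commute)
  show "torus_dist \<mu> p q = 0 \<longleftrightarrow> p = q"
    using torus_dist_eq_0D[OF assms, of p q] torus_dist_self[OF assms, of p] by auto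
  show "torus_dist \<mu> p r \<le> torus_dist \<mu> p q + torus_dist \<mu> q r"
    by (rule torus_dist_triangle[OF assms])
qed

text \<open>The torus at height 0 has diameter at most the dimension, and vertical lines are unit speed. Hence balls around
the origin contain all slices up to a height that differs from the radius by a constant.\<close>

lemma torus_dist_origin_le:
  fixes \<mu> :: "'n::finite \<Rightarrow> real"
  assumes "\<forall>i. \<mu> i \<ge> 0"
  shows "torus_dist \<mu> origin (torus_proj p) \<le> \<bar>snd p\<bar> + CARD('n)"
proof -
  define x :: "real ^ 'n" where "x = (\<chi> i. frac (fst p $ i))"
  have "fst p $ i - x $ i \<in> \<int>" for i by (simp add: x_def frac_def)
  then have p: "torus_proj p = torus_proj (x, snd p)" by (simp add: torus_proj_eq_iff)
  have "torus_dist \<mu> (torus_proj 0) (torus_proj (x, 0)) \<le> (\<Sum>i\<in>UNIV. \<bar>x $ i\<bar>)"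
    using torus_dist_le_line[OF assms, of 0 0 "(x, 0)"] by simp
  also have "\<dots> \<le> (\<Sum>i\<in>(UNIV::'n set). 1)"
    by (rule sum_mono) (simp add: x_def frac_lt_1 less_imp_le)
  finally have 1: "torus_dist \<mu> origin (torus_proj (x, 0)) \<le> CARD('n)" by (simp add: origin_def)
  have 2: "torus_dist \<mu> (torus_proj (x, 0)) (torus_proj p) \<le> \<bar>snd p\<bar>"
    using torus_dist_le_line[OF assms, of "(x, 0)" "max 0 (snd p)" "(x, snd p)"] p by simp
  show ?thesis
    using torus_dist_triangle[OF assms, of origin "torus_proj p" "torus_proj (x, 0)"] 1 2 by simp
qed

lemma abs_height_diff_le_torus_dist:
  assumes "\<forall>i. \<mu> i \<ge> 0"
  shows "\<bar>snd q - snd p\<bar> \<le> torus_dist \<mu> p q"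
proof (rule field_le_epsilon)
  fix e :: real assume "0 < e"
  obtain x y where xy: "p = torus_proj x" "q = torus_proj y" by (metis torus_proj_surj)
  have "torus_dist \<mu> (torus_proj x) (torus_proj y) < torus_dist \<mu> p q + e"
    using xy \<open>0 < e\<close> by simp
  then have "\<bar>snd y - snd x\<bar> \<le> torus_dist \<mu> p q + e"
    by (rule torus_dist_displacement[OF assms])
  then show "\<bar>snd q - snd p\<bar> \<le> torus_dist \<mu> p q + e"
    using xy by simp
qed

lemma continuous_map_torus_proj:
  fixes \<mu> :: "'n::finite \<Rightarrow> real"
  assumes "\<forall>i. \<mu> i \<ge> 0"
  shows "continuous_map euclidean (Metric_space.mtopology UNIV (torus_dist \<mu>)) torus_proj"
proof -
  interpret Metric_space UNIV "torus_dist \<mu>" by (rule Metric_space_torus[OF assms])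
  have "\<exists>U. open U \<and> p \<in> U \<and> (\<forall>q\<in>U. torus_proj q \<in> mball (torus_proj p) e)" if "e > 0" for p e
  proof -
    define F where "F q = \<bar>snd q - snd p\<bar>
      + (\<Sum>i\<in>UNIV. exp (\<mu> i * (snd p + 1)) * \<bar>fst q $ i - fst p $ i\<bar>)" for q :: "(real ^ 'n) \<times> real"
    have "open {q. snd q < snd p + 1 \<and> F q < e}"
      unfolding F_def by (intro open_Collect_conj open_Collect_less continuous_intros)
    moreover have "p \<in> {q. snd q < snd p + 1 \<and> F q < e}" using that by (simp add: F_def)
    moreover have "torus_proj q \<in> mball (torus_proj p) e" if "snd q < snd p + 1 \<and> F q < e" for q
      using torus_dist_le_line[OF assms, of p "snd p + 1" q] that by (simp add: F_def)
    ultimately show ?thesis by blast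
  qed
  then show ?thesis by (auto simp: continuous_map_to_metric)
qed

section \<open>Lifting maps to the covering space\<close>

abbreviation torus_topology :: "('n::finite \<Rightarrow> real) \<Rightarrow> ('n torus \<times> real) topology" where
  "torus_topology \<mu> \<equiv> Metric_space.mtopology UNIV (torus_dist \<mu>)"

lemma continuous_map_height:
  assumes "\<forall>i. \<mu> i \<ge> 0"
  shows "continuous_map (torus_topology \<mu>) euclideanreal snd"
proof -
  interpret Metric_space UNIV "torus_dist \<mu>" by (rule Metric_space_torus[OF assms])
  have "\<exists>r>0. \<forall>q. torus_dist \<mu> p q < r \<longrightarrow> snd q \<in> U" if U: "open U" "snd p \<in> U" for p U
  proof -
    obtain r where "r > 0" "\<And>t. dist t (snd p) < r \<Longrightarrow> t \<in> U"
      using U unfolding open_dist by metis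
    moreover have "dist (snd q) (snd p) \<le> torus_dist \<mu> p q" for q
      using abs_height_diff_le_torus_dist[OF assms] by (simp add: dist_real_def)
    ultimately show ?thesis by (meson order_le_less_trans)
  qed
  then show ?thesis by (auto simp: continuous_map_from_metric)
qed

text \<open>The map \<open>(x, t) \<mapsto> exp (2 \<pi> \<i> x\<^sub>i)\<close>. Together with the height these functions separate the points of the
quotient, which reduces the lifting of maps to the existence of continuous logarithms.\<close>

definition circle_coord :: "'n \<Rightarrow> 'n::finite torus \<times> real \<Rightarrow> complex" where
  "circle_coord i q = exp (complex_of_real (2 * pi * rep_torus (fst q) $ i) * \<i>)"

lemma exp_turn_eq_iff:
  "exp (complex_of_real (2 * pi * x) * \<i>) = exp (complex_of_real (2 * pi * y) * \<i>) \<longleftrightarrow> x - y \<in> \<int>"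
proof -
  have "complex_of_real (2 * pi * x) * \<i> = complex_of_real (2 * pi * y) * \<i> + (of_int (2 * n) * pi) * \<i>
      \<longleftrightarrow> x = y + n" for n :: int
  proof -
    have "complex_of_real (2 * pi * x) * \<i> = complex_of_real (2 * pi * y) * \<i> + (of_int (2 * n) * pi) * \<i>
      \<longleftrightarrow> 2 * pi * x = 2 * pi * (y + n)"
      by (simp add: complex_eq_iff distrib_left mult_ac)
    then show ?thesis by simp
  qed
  then have "exp (complex_of_real (2 * pi * x) * \<i>) = exp (complex_of_real (2 * pi * y) * \<i>)
      \<longleftrightarrow> (\<exists>n::int. x = y + n)"
    unfolding exp_eq by presburger
  also have "\<dots> \<longleftrightarrow> x - y \<in> \<int>"
    by (auto simp: Ints_def algebra_simps)
  finally show ?thesis .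
qed

lemma circle_coord_torus_proj:
  "circle_coord i (torus_proj p) = exp (complex_of_real (2 * pi * fst p $ i) * \<i>)"
proof -
  have "lattice_rel (rep_torus (abs_torus (fst p))) (fst p)"
    by (metis Quotient_abs_rep Quotient_torus torus.abs_eq_iff)
  then show ?thesis
    unfolding circle_coord_def torus_proj_def fst_conv exp_turn_eq_iff
    by (simp add: lattice_rel_def)
qed

lemma continuous_map_circle_coord:
  assumes "\<forall>i. \<mu> i \<ge> 0"
  shows "continuous_map (torus_topology \<mu>) euclidean (circle_coord i)"
proof -
  interpret Metric_space UNIV "torus_dist \<mu>" by (rule Metric_space_torus[OF assms])
  have "\<exists>r>0. \<forall>q. torus_dist \<mu> p q < r \<longrightarrow> circle_coord i q \<in> U"
    if U: "open U" "circle_coord i p \<in> U" for p U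
  proof -
    obtain x where p: "p = torus_proj x" by (metis torus_proj_surj)
    define c where "c u = exp (complex_of_real (2 * pi * u) * \<i>)" for u
    have "open (c -` U)"
      unfolding c_def by (intro open_vimage U continuous_intros)
    moreover have "fst x $ i \<in> c -` U"
      using U p by (simp add: c_def circle_coord_torus_proj)
    ultimately obtain e where "e > 0" "ball (fst x $ i) e \<subseteq> c -` U"
      by (meson open_contains_ball)
    then have e: "e > 0" "\<And>u. dist u (fst x $ i) < e \<Longrightarrow> c u \<in> U"
      by (auto simp: dist_commute)
    obtain r where r: "r > 0" "\<forall>q. torus_dist \<mu> (torus_proj x) (torus_proj q) < r \<longrightarrow>
        (\<exists>m\<in>\<int>. \<bar>fst q $ i + m - fst x $ i\<bar> < e)"
      by (rule torus_dist_small_displacement[OF assms e(1), of x i])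
    have "circle_coord i q \<in> U" if d: "torus_dist \<mu> p q < r" for q
    proof -
      obtain y where y: "q = torus_proj y" by (metis torus_proj_surj)
      obtain m where m: "m \<in> \<int>" "\<bar>fst y $ i + m - fst x $ i\<bar> < e"
        using r(2) d p y by blast
      have "c (fst y $ i + m) \<in> U" using e(2) m(2) by (simp add: dist_real_def)
      moreover have "c (fst y $ i + m) = c (fst y $ i)"
        unfolding c_def exp_turn_eq_iff using m(1) by simp
      ultimately show ?thesis by (simp add: y circle_coord_torus_proj c_def)
    qed
    with r(1) show ?thesis by blast
  qed
  then show ?thesis by (auto simp: continuous_map_from_metric)
qed

lemma lift_exists:
  fixes S :: "'b::real_normed_vector set" and \<mu> :: "'n::finite \<Rightarrow> real"
  assumes "\<forall>i. \<mu> i \<ge> 0" "convex S" "continuous_map (top_of_set S) (torus_topology \<mu>) h"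
  obtains k where "continuous_on S k" "\<forall>z\<in>S. torus_proj (k z) = h z"
proof -
  have "\<exists>g. continuous_on S g \<and> (\<forall>z\<in>S. circle_coord i (h z) = exp (g z))" for i
  proof -
    have "continuous_on S (circle_coord i \<circ> h)"
      using continuous_map_compose[OF assms(3) continuous_map_circle_coord[OF assms(1)]]
      by (simp add: continuous_map_iff_continuous)
    moreover have "contractible S" by (rule convex_imp_contractible[OF assms(2)])
    ultimately obtain g where "continuous_on S g" "\<And>z. z \<in> S \<Longrightarrow> (circle_coord i \<circ> h) z = exp (g z)"
      by (rule continuous_logarithm_on_contractible) (auto simp: circle_coord_def)
    then show ?thesis by auto
  qed
  then obtain g where g: "\<And>i. continuous_on S (g i)" "\<And>i z. z \<in> S \<Longrightarrow> circle_coord i (h z) = exp (g i z)"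
    by metis
  define k where "k z = ((\<chi> i. Im (g i z) / (2 * pi)), snd (h z))" for z
  have "continuous_on S (snd \<circ> h)"
    using continuous_map_compose[OF assms(3) continuous_map_height[OF assms(1)]]
    by (simp add: continuous_map_iff_continuous)
  then have "continuous_on S k"
    unfolding k_def using g(1) by (intro continuous_intros) (auto simp: o_def)
  moreover have "torus_proj (k z) = h z" if "z \<in> S" for z
  proof -
    obtain y where y: "h z = torus_proj y" by (metis torus_proj_surj)
    have "fst (k z) $ i - fst y $ i \<in> \<int>" for i
    proof -
      have "exp (complex_of_real (2 * pi * fst y $ i) * \<i>) = exp (g i z)"
        using g(2)[OF that, of i] by (simp add: y circle_coord_torus_proj)
      then obtain n :: int where
        "complex_of_real (2 * pi * fst y $ i) * \<i> = g i z + (of_int (2 * n) * pi) * \<i>"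
        unfolding exp_eq by blast
      then have "2 * pi * fst y $ i = Im (g i z) + 2 * n * pi"
        by (simp add: complex_eq_iff)
      then have "fst (k z) $ i - fst y $ i = of_int (- n)"
        by (simp add: k_def field_simps)
      then show ?thesis by (metis Ints_of_int)
    qed
    moreover have "snd (k z) = snd y" by (simp add: k_def y)
    ultimately show ?thesis by (simp add: y torus_proj_eq_iff)
  qed
  ultimately show ?thesis using that by blast
qed

lemma continuous_integer_valued_constant:
  fixes g :: "'b::topological_space \<Rightarrow> real"
  assumes "connected S" "continuous_on S g" "\<And>z. z \<in> S \<Longrightarrow> g z \<in> \<int>"
  shows "g constant_on S"
proof (rule continuous_discrete_range_constant[OF assms(1,2)])
  fix x assume x: "x \<in> S"
  have "1 \<le> norm (g y - g x)" if "y \<in> S" "g y \<noteq> g x" for y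
    using that x assms(3) Ints_nonzero_abs_ge1[of "g y - g x"] by auto
  then show "\<exists>e>0. \<forall>y. y \<in> S \<and> g y \<noteq> g x \<longrightarrow> e \<le> norm (g y - g x)"
    by (intro exI[of _ 1]) auto
qed

text \<open>The difference of two lifts has integer coordinates, so it is locally constant.\<close>

lemma lifts_differ_by_constant:
  fixes k l :: "'b::topological_space \<Rightarrow> (real ^ 'n) \<times> real"
  assumes "connected S" "continuous_on S k" "continuous_on S l"
    and eq: "\<And>z. z \<in> S \<Longrightarrow> torus_proj (k z) = torus_proj (l z)"
  obtains v where "integer_vec v" "\<forall>z\<in>S. k z = l z + (v, 0)"
proof (cases "S = {}")
  case True
  then show ?thesis using that[of 0] by (simp add: integer_vec_def)
next
  case False
  then obtain z0 where z0: "z0 \<in> S" by blast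
  define v where "v = fst (k z0) - fst (l z0)"
  have int: "fst (k z) $ i - fst (l z) $ i \<in> \<int>" and ht: "snd (k z) = snd (l z)" if "z \<in> S" for z i
    using eq[OF that] by (auto simp: torus_proj_eq_iff)
  have "fst (k z) $ i - fst (l z) $ i = v $ i" if "z \<in> S" for z i
  proof -
    have "(\<lambda>z. fst (k z) $ i - fst (l z) $ i) constant_on S"
      by (rule continuous_integer_valued_constant[OF assms(1)])
        (use assms(2,3) int in \<open>auto intro!: continuous_intros\<close>)
    then show ?thesis using z0 that by (auto simp: constant_on_def v_def)
  qed
  moreover have "integer_vec v" using int[OF z0] by (simp add: integer_vec_def v_def)
  ultimately show ?thesis
    by (intro that[of v]) (auto simp: prod_eq_iff vec_eq_iff ht, metis add_diff_cancel_left' diff_add_cancel add.commute)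
qed

text \<open>\<open>W\<close> is the action of the map on the deck transformations, that is, on the fundamental group.\<close>

lemma lift_equivariant:
  fixes k :: "(real ^ 'n) \<times> real \<Rightarrow> (real ^ 'm) \<times> real"
  assumes "connected S" "continuous_on S k"
    and lift: "\<And>z. z \<in> S \<Longrightarrow> torus_proj (k z) = h (torus_proj z)"
    and inv: "\<And>z v. z \<in> S \<Longrightarrow> z + (v, 0) \<in> S"
  obtains W where "\<forall>v. integer_vec v \<longrightarrow> integer_vec (W v)"
    "\<forall>z\<in>S. \<forall>v. integer_vec v \<longrightarrow> k (z + (v, 0)) = k z + (W v, 0)"
proof -
  have "\<exists>w. integer_vec w \<and> (\<forall>z\<in>S. k (z + (v, 0)) = k z + (w, 0))" if v: "integer_vec v" for v
  proof -
    have "continuous_on S (\<lambda>z. k (z + (v, 0)))"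
      by (rule continuous_on_compose2[OF assms(2)]) (use inv in \<open>auto intro!: continuous_intros\<close>)
    moreover have "torus_proj (k (z + (v, 0))) = torus_proj (k z)" if "z \<in> S" for z
      using lift[OF that] lift[OF inv[OF that]] torus_proj_translate[OF v] by simp
    ultimately obtain w where "integer_vec w" "\<forall>z\<in>S. k (z + (v, 0)) = k z + (w, 0)"
      by (rule lifts_differ_by_constant[OF assms(1) _ assms(2)])
    then show ?thesis by blast
  qed
  then show ?thesis using that by metis
qed

text \<open>This allows homomorphisms of the lattice to be treated as real matrices.\<close>

lemma additive_on_integer_vecs:
  fixes D :: "real ^ 'n::finite \<Rightarrow> 'b::real_vector"
  assumes add: "\<And>v w. integer_vec v \<Longrightarrow> integer_vec w \<Longrightarrow> D (v + w) = D v + D w"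
    and w: "integer_vec w"
  shows "D w = (\<Sum>k\<in>UNIV. w $ k *\<^sub>R D (axis k 1))"
proof -
  have zero: "D 0 = 0" using add[of 0 0] by (simp add: integer_vec_def)
  have nat: "D (real m *\<^sub>R v) = real m *\<^sub>R D v" if v: "integer_vec v" for m v
  proof (induction m)
    case (Suc m)
    have "integer_vec (real m *\<^sub>R v)" using v by (simp add: integer_vec_def)
    then show ?case using Suc add[OF v, of "real m *\<^sub>R v"] by (simp add: scaleR_add_left)
  qed (simp add: zero)
  have int: "D (x *\<^sub>R v) = x *\<^sub>R D v" if v: "integer_vec v" and "x \<in> \<int>" for x v
  proof -
    have neg: "D (- u) = - D u" if "integer_vec u" for u
      using add[of u "- u"] that zero by (simp add: integer_vec_def eq_neg_iff_add_eq_0 add.commute)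
    obtain m :: nat where "x = real m \<or> x = - real m"
      using \<open>x \<in> \<int>\<close> by (metis Ints_cases int_cases2 of_int_minus of_int_of_nat_eq)
    moreover have "integer_vec (real m *\<^sub>R v)" using v by (simp add: integer_vec_def)
    ultimately show ?thesis using nat[OF v, of m] neg[of "real m *\<^sub>R v"] by auto
  qed
  have ax: "integer_vec (axis k 1 :: real ^ 'n)" for k by (simp add: integer_vec_def axis_def)
  have "D (\<Sum>k\<in>A. w $ k *\<^sub>R axis k 1) = (\<Sum>k\<in>A. w $ k *\<^sub>R D (axis k 1))" if "finite A" for A
    using that
  proof (induction A)
    case (insert a A)
    have "integer_vec (w $ a *\<^sub>R axis a 1 :: real ^ 'n)"
      using w by (simp add: integer_vec_def axis_def)
    moreover have "integer_vec (\<Sum>k\<in>A. w $ k *\<^sub>R axis k 1 :: real ^ 'n)"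
      using w by (auto simp: integer_vec_def axis_def intro!: Ints_sum)
    moreover have "D (w $ a *\<^sub>R axis a 1) = w $ a *\<^sub>R D (axis a 1)"
      using int[OF ax] w by (simp add: integer_vec_def)
    ultimately show ?case using insert add by simp
  qed (simp add: zero)
  moreover have "(\<Sum>k\<in>UNIV. w $ k *\<^sub>R axis k 1) = w"
    using basis_expansion[of w] by (simp add: scalar_mult_eq_scaleR)
  ultimately show ?thesis by (metis finite)
qed

text \<open>The only topological input: \<open>f\<close> lifts over the slab and its action \<open>W\<close> on the lattice misses no
coordinate of the target. A homotopy inverse \<open>g\<close> acts by some \<open>V\<close> on the lattice. Lifting the
homotopy from \<open>g \<circ> f\<close> to the identity along a coordinate loop gives \<open>V (W (axis j 1)) = axis j 1\<close>.
Since \<open>V\<close> and \<open>W\<close> are given by square matrices, this one-sided identity makes \<open>W\<close> invertible,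
and an invertible matrix has no zero row.\<close>

lemma homotopy_equivalence_lift:
  fixes \<mu> \<mu>' :: "'n::finite \<Rightarrow> real" and U :: "('n torus \<times> real) set"
  assumes \<mu>: "\<forall>i. \<mu> i \<ge> 0" and \<mu>': "\<forall>i. \<mu>' i \<ge> 0" and "0 \<le> T"
    and U: "\<And>p. 0 \<le> snd p \<Longrightarrow> snd p \<le> T \<Longrightarrow> torus_proj p \<in> U"
    and f: "homotopy_equivalence_map (subtopology (torus_topology \<mu>) U) (torus_topology \<mu>') f"
  obtains F W where "continuous_on {p. 0 \<le> snd p \<and> snd p \<le> T} F"
    "\<And>p. 0 \<le> snd p \<Longrightarrow> snd p \<le> T \<Longrightarrow> torus_proj (F p) = f (torus_proj p)"
    "\<And>v. integer_vec v \<Longrightarrow> integer_vec (W v)"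
    "\<And>p v. 0 \<le> snd p \<Longrightarrow> snd p \<le> T \<Longrightarrow> integer_vec v \<Longrightarrow> F (p + (v, 0)) = F p + (W v, 0)"
    "\<And>k. \<exists>i. W (axis i 1) $ k \<noteq> 0"
proof -
  let ?X = "subtopology (torus_topology \<mu>) U"
  let ?Y = "torus_topology \<mu>'"
  define S :: "((real ^ 'n) \<times> real) set" where "S = {p. 0 \<le> snd p \<and> snd p \<le> T}"
  interpret X: Metric_space UNIV "torus_dist \<mu>" by (rule Metric_space_torus[OF \<mu>])
  obtain g where fc: "continuous_map ?X ?Y f" and gc: "continuous_map ?Y ?X g"
    and gf: "homotopic_with (\<lambda>x. True) ?X ?X (g \<circ> f) id"
    using f unfolding homotopy_equivalence_map_def by blast
  have "convex S"
  proof -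
    have "S = UNIV \<times> {0..T}" by (auto simp: S_def)
    then show ?thesis by (simp add: convex_Times)
  qed
  have projS: "continuous_map (top_of_set S) ?X torus_proj"
    using continuous_map_torus_proj[OF \<mu>] U
    by (auto simp: continuous_map_in_subtopology S_def intro: continuous_map_from_subtopology)
  obtain F where F: "continuous_on S F" "\<forall>z\<in>S. torus_proj (F z) = (f \<circ> torus_proj) z"
    by (rule lift_exists[OF \<mu>' \<open>convex S\<close> continuous_map_compose[OF projS fc]])
  have gproj: "continuous_map (top_of_set UNIV) (torus_topology \<mu>) (g \<circ> torus_proj)"
    using continuous_map_compose[OF continuous_map_torus_proj[OF \<mu>'] continuous_map_into_fulltopology[OF gc]]
    by simp
  obtain G where G: "continuous_on UNIV G" "\<forall>z\<in>UNIV. torus_proj (G z) = (g \<circ> torus_proj) z"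
    by (rule lift_exists[OF \<mu> convex_UNIV gproj])
  obtain W where W: "\<forall>v. integer_vec v \<longrightarrow> integer_vec (W v)"
    "\<forall>z\<in>S. \<forall>v. integer_vec v \<longrightarrow> F (z + (v, 0)) = F z + (W v, 0)"
    by (rule lift_equivariant[OF convex_connected[OF \<open>convex S\<close>] F(1), of f])
      (use F(2) in \<open>auto simp: S_def\<close>)
  obtain V where V: "\<forall>v. integer_vec v \<longrightarrow> integer_vec (V v)"
    "\<forall>z\<in>UNIV. \<forall>v. integer_vec v \<longrightarrow> G (z + (v, 0)) = G z + (V v, 0)"
    by (rule lift_equivariant[OF connected_UNIV G(1), of g]) (use G(2) in auto)
  have ax: "integer_vec (axis k 1 :: real ^ 'n)" for k by (simp add: integer_vec_def axis_def)
  have VW: "V (W (axis j 1)) = axis j 1" for j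
  proof -
    from gf[unfolded homotopic_with_def]
    obtain H where H: "continuous_map (prod_topology (top_of_set {0..1::real}) ?X) ?X H"
      "\<forall>x. H (0, x) = (g \<circ> f) x" "\<forall>x. H (1, x) = id x"
      by (elim exE conjE)
    let ?Q = "{0..1} \<times> {0..1} :: (real \<times> real) set"
    \<comment> \<open>The homotopy applied to the \<open>j\<close>-th coordinate loop at height 0 is a map of a square, which lifts.\<close>
    let ?loop = "\<lambda>s::real. (s *\<^sub>R axis j 1, 0) :: (real ^ 'n) \<times> real"
    have cvx: "convex ?Q" by (intro convex_Times) auto
    have "continuous_map (top_of_set ?Q) ?X (\<lambda>z. torus_proj (?loop (snd z)))"
    proof -
      have "continuous_map (top_of_set ?Q) (top_of_set S) (\<lambda>z. ?loop (snd z))"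
        using \<open>0 \<le> T\<close> by (auto simp: continuous_map_in_subtopology S_def intro!: continuous_intros)
      from continuous_map_compose[OF this projS] show ?thesis by (simp add: o_def)
    qed
    moreover have "continuous_map (top_of_set ?Q) (top_of_set {0..1}) fst"
      by (auto simp: continuous_map_in_subtopology intro!: continuous_intros)
    ultimately have "continuous_map (top_of_set ?Q) (prod_topology (top_of_set {0..1}) ?X)
        (\<lambda>z. (fst z, torus_proj (?loop (snd z))))"
      by (simp add: continuous_map_pairedI)
    from continuous_map_compose[OF this H(1)]
    have "continuous_map (top_of_set ?Q) (torus_topology \<mu>) (\<lambda>z. H (fst z, torus_proj (?loop (snd z))))"
      using continuous_map_into_fulltopology by (auto simp: o_def)
    then obtain K where K: "continuous_on ?Q K"
      "\<forall>z\<in>?Q. torus_proj (K z) = H (fst z, torus_proj (?loop (snd z)))"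
      by (rule lift_exists[OF \<mu> cvx])
    have KcI: "continuous_on {0..1} (\<lambda>s. K (a s, b s))"
      if "continuous_on {0..1} a" "continuous_on {0..1} b" "a ` {0..1} \<subseteq> {0..1}" "b ` {0..1} \<subseteq> {0..1}"
      for a b :: "real \<Rightarrow> real"
      by (rule continuous_on_compose2[OF K(1)]) (use that in \<open>auto intro!: continuous_intros\<close>)
    have per: "torus_proj (?loop 1) = torus_proj (?loop 0)"
      using torus_proj_translate[OF ax[of j], of 0] by (simp add: zero_prod_def)
    \<comment> \<open>The end points of the lifted loops differ by the same lattice vector \<open>u\<close> for all \<open>\<tau>\<close>.\<close>
    obtain u where u: "\<forall>\<tau>\<in>{0..1}. K (\<tau>, 1) = K (\<tau>, 0) + (u, 0)"
      by (rule lifts_differ_by_constant[of "{0..1::real}" "\<lambda>\<tau>. K (\<tau>, 1)" "\<lambda>\<tau>. K (\<tau>, 0)"])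
        (use K(2) per in \<open>auto intro!: KcI\<close>)
    obtain c where c: "\<forall>s\<in>{0..1}. K (1, s) = ?loop s + (c, 0)"
      by (rule lifts_differ_by_constant[of "{0..1::real}" "\<lambda>s. K (1, s)" ?loop])
        (use K(2) H(3)[rule_format] in \<open>auto intro!: KcI continuous_intros\<close>)
    have "u = axis j 1" using u[rule_format, of 1] c[rule_format, of 0] c[rule_format, of 1] by simp
    have loopS: "?loop s \<in> S" for s using \<open>0 \<le> T\<close> by (simp add: S_def)
    have GFc: "continuous_on {0..1} (\<lambda>s. G (F (?loop s)))"
      by (rule continuous_on_compose2[OF G(1)], rule continuous_on_compose2[OF F(1)])
        (use loopS in \<open>auto intro!: continuous_intros\<close>)
    have Kc: "continuous_on {0..1} (\<lambda>s. K (0, s))"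
      by (auto intro!: KcI)
    have same: "torus_proj (K (0, s)) = torus_proj (G (F (?loop s)))" if "s \<in> {0..1}" for s
      using K(2)[rule_format, of "(0, s)"] H(2)[rule_format] G(2)[rule_format]
        F(2)[rule_format, OF loopS, of s] that by simp
    obtain c' where c': "\<forall>s\<in>{0..1}. K (0, s) = G (F (?loop s)) + (c', 0)"
      by (rule lifts_differ_by_constant[OF connected_Icc Kc GFc same])
    have "F (?loop 1) = F (?loop 0) + (W (axis j 1), 0)"
      using W(2)[rule_format, OF loopS ax, of 0 j] by simp
    then have "G (F (?loop 1)) = G (F (?loop 0)) + (V (W (axis j 1)), 0)"
      using V(2)[rule_format, OF _ W(1)[rule_format, OF ax]] by simp
    then have "u = V (W (axis j 1))" using u[rule_format, of 0] c'[rule_format, of 0] c'[rule_format, of 1] by simp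
    with \<open>u = axis j 1\<close> show ?thesis by simp
  qed
  have "V (v + w) = V v + V w" if "integer_vec v" "integer_vec w" for v w
  proof -
    have "integer_vec (v + w)" using that by (simp add: integer_vec_def)
    then have "G 0 + (V (v + w), 0) = G ((v, 0) + (w, 0))"
      using V(2)[rule_format, of 0 "v + w"] by simp
    also have "\<dots> = G 0 + (V v, 0) + (V w, 0)"
      using V(2)[rule_format, of "(v, 0)" w] V(2)[rule_format, of 0 v] that by simp
    finally show ?thesis by (simp add: prod_eq_iff)
  qed
  then have Vlin: "V w = (\<Sum>k\<in>UNIV. w $ k *\<^sub>R V (axis k 1))" if "integer_vec w" for w
    using additive_on_integer_vecs[of V w] that by blast
  define VM :: "real ^ 'n ^ 'n" where "VM = (\<chi> r k. V (axis k 1) $ r)"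
  define WM :: "real ^ 'n ^ 'n" where "WM = (\<chi> k j. W (axis j 1) $ k)"
  have "(VM ** WM) $ r $ j = mat 1 $ r $ j" for r j
  proof -
    have "(VM ** WM) $ r $ j = V (W (axis j 1)) $ r"
      using Vlin[OF W(1)[rule_format, OF ax[of j]]]
      by (simp add: matrix_matrix_mult_def VM_def WM_def mult.commute)
    then show ?thesis unfolding VW by (simp add: mat_def axis_def)
  qed
  then have "VM ** WM = mat 1" by (simp add: vec_eq_iff)
  then have "WM ** VM = mat 1" by (simp add: matrix_left_right_inverse)
  have nz: "\<exists>i. W (axis i 1) $ k \<noteq> 0" for k
  proof (rule ccontr)
    assume "\<not> (\<exists>i. W (axis i 1) $ k \<noteq> 0)"
    then have "(WM ** VM) $ k $ k = 0" by (simp add: matrix_matrix_mult_def WM_def)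
    with \<open>WM ** VM = mat 1\<close> show False by (simp add: mat_def)
  qed
  show ?thesis
    by (rule that[of F W]) (use F W nz in \<open>auto simp: S_def\<close>)
qed

section \<open>Weights along a circuit\<close>

lemma powr_ge_tangent:
  fixes x c p :: real
  assumes "1 \<le> p" "0 \<le> x" "0 < c"
  shows "c powr p + p * c powr (p - 1) * (x - c) \<le> x powr p"
proof (cases "x = 0")
  case True
  have "c powr (p - 1) * c = c powr p" using assms by (simp add: powr_mult_base[symmetric] powr_diff)
  then have "c powr p + p * c powr (p - 1) * (x - c) = (1 - p) * c powr p"
    by (simp add: True algebra_simps)
  also have "\<dots> \<le> 0" using assms by (simp add: mult_nonpos_nonneg)
  finally show ?thesis by (simp add: True)
next
  case False
  have "((x / c) powr p) powr (1 / p) * 1 powr (1 - 1 / p) \<le> 1 / p * (x / c) powr p + (1 - 1 / p) * 1"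
    by (rule Youngs_inequality_0) (use assms False in auto)
  then have "x / c \<le> 1 / p * (x / c) powr p + (1 - 1 / p)"
    using assms False by (simp add: powr_powr)
  then have "p * (x / c) \<le> p * (1 / p * (x / c) powr p + (1 - 1 / p))"
    using assms by (intro mult_left_mono) auto
  then have "p * (x / c) \<le> (x / c) powr p + (p - 1)"
    using assms by (simp add: distrib_left right_diff_distrib)
  then have "(1 + p * (x / c - 1)) * c powr p \<le> (x / c) powr p * c powr p"
    by (intro mult_right_mono) (auto simp: algebra_simps)
  also have "\<dots> = x powr p" using assms by (simp add: powr_divide)
  finally have "(1 + p * (x / c - 1)) * c powr p \<le> x powr p" .
  moreover have "c powr p = c powr (p - 1) * c" using assms by (simp add: powr_diff)
  then have "(1 + p * (x / c - 1)) * c powr p = c powr p + p * c powr (p - 1) * (x - c)"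
    using assms by (simp add: field_simps)
  ultimately show ?thesis by simp
qed

text \<open>Each term is bounded below by the tangent of \<open>x powr p\<close> at the mean value \<open>1 / N\<close>.\<close>

lemma power_mean_lower_bound:
  fixes w :: "nat \<Rightarrow> real" and p :: real
  assumes "1 \<le> p" "0 < N" "\<And>k. 0 \<le> w k" "1 \<le> (\<Sum>k<N. w k)"
  shows "real N powr (1 - p) \<le> (\<Sum>k<N. w k powr p)"
proof -
  let ?c = "1 / real N"
  have c: "real N * ?c powr p = real N powr (1 - p)"
    using assms(2) by (simp add: powr_diff powr_divide)
  have "real N powr (1 - p) \<le> real N * ?c powr p + p * ?c powr (p - 1) * ((\<Sum>k<N. w k) - 1)"
    using assms unfolding c by simp
  also have "\<dots> = (\<Sum>k<N. ?c powr p + p * ?c powr (p - 1) * (w k - ?c))"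
    using assms(2) by (simp add: sum.distrib sum_subtractf flip: sum_distrib_left)
  also have "\<dots> \<le> (\<Sum>k<N. w k powr p)"
    using assms by (intro sum_mono powr_ge_tangent) auto
  finally show ?thesis .
qed

text \<open>By continuity the values cannot move from the integer 0 to another one: they would have to cross
\<open>1/2\<close> or \<open>-1/2\<close>, which is farther than \<open>r\<close> from every integer.\<close>

lemma trapped_near_integers:
  fixes \<phi> :: "real \<Rightarrow> real"
  assumes "a \<le> b" "continuous_on {a..b} \<phi>" "r < 1/2"
    and near: "\<And>s. s \<in> {a..b} \<Longrightarrow> \<exists>m\<in>\<int>. \<bar>\<phi> s - \<phi> a - m\<bar> \<le> r"
  shows "\<bar>\<phi> b - \<phi> a\<bar> \<le> r"
proof (rule ccontr)
  assume neg: "\<not> ?thesis"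
  let ?\<psi> = "\<lambda>s. \<bar>\<phi> s - \<phi> a\<bar>"
  obtain m where m: "m \<in> \<int>" "\<bar>\<phi> b - \<phi> a - m\<bar> \<le> r" using near[of b] assms(1) by auto
  with neg have "m \<noteq> 0" by auto
  with m have "1 \<le> \<bar>m\<bar>" using Ints_nonzero_abs_ge1 by blast
  with m assms(3) have "1/2 \<le> ?\<psi> b" by linarith
  moreover have "?\<psi> a \<le> 1/2" by simp
  moreover have "continuous_on {a..b} ?\<psi>" using assms(2) by (intro continuous_intros)
  ultimately obtain s where s: "a \<le> s" "s \<le> b" "?\<psi> s = 1/2"
    using IVT'[of ?\<psi> a "1/2" b] assms(1) by blast
  obtain k where k: "k \<in> \<int>" "\<bar>\<phi> s - \<phi> a - k\<bar> \<le> r" using near[of s] s by auto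
  show False
  proof (cases "k = 0")
    case False
    with k have "1 \<le> \<bar>k\<bar>" using Ints_nonzero_abs_ge1 by blast
    with k s(3) assms(3) show False by linarith
  qed (use k s(3) assms(3) in auto)
qed

text \<open>A function that makes a full turn while on each of \<open>N\<close> steps it is known only modulo 1 up to an
error \<open>r k\<close>. Where \<open>r k < 1/2\<close> the error controls the true displacement. A step with a larger error may turn
arbitrarily often, but then its capped weight is already 1; this is what the cap and the factor 2
are for.\<close>

lemma circuit_weight_ge_1:
  fixes \<phi> :: "real \<Rightarrow> real" and r :: "nat \<Rightarrow> real"
  assumes "0 < N" "continuous_on {0..1} \<phi>" "1 \<le> \<bar>\<phi> 1 - \<phi> 0\<bar>"
    and near: "\<And>k s. k < N \<Longrightarrow> real k / N \<le> s \<Longrightarrow> s \<le> (real k + 1) / N \<Longrightarrow>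
      \<exists>m\<in>\<int>. \<bar>\<phi> s - \<phi> (real k / N) - m\<bar> \<le> r k"
  shows "1 \<le> (\<Sum>k<N. min 1 (2 * r k))"
proof -
  have r: "0 \<le> r k" if "k < N" for k
    using near[OF that, of "real k / N"] by (auto simp: divide_right_mono)
  show ?thesis
  proof (cases "\<forall>k<N. r k < 1/2")
    case False
    then obtain k where k: "k < N" "1/2 \<le> r k" by force
    then have "1 = min 1 (2 * r k)" by simp
    also have "\<dots> \<le> (\<Sum>k<N. min 1 (2 * r k))"
      by (rule member_le_sum[where f = "\<lambda>k. min 1 (2 * r k)"]) (use k r in auto)
    finally show ?thesis .
  next
    case True
    have step: "\<bar>\<phi> (real (Suc k) / N) - \<phi> (real k / N)\<bar> \<le> r k" if k: "k < N" for k
    proof (rule trapped_near_integers[of "real k / N" "real (Suc k) / N" \<phi>])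
      have "{real k / N..real (Suc k) / N} \<subseteq> {0..1}" using k by (auto simp: field_simps)
      with assms(2) show "continuous_on {real k / N..real (Suc k) / N} \<phi>"
        by (rule continuous_on_subset)
      show "r k < 1/2" using True k by simp
      show "\<exists>m\<in>\<int>. \<bar>\<phi> s - \<phi> (real k / N) - m\<bar> \<le> r k" if "s \<in> {real k / N..real (Suc k) / N}" for s
        using near[OF k, of s] that by (simp add: add.commute)
    qed (simp add: divide_right_mono)
    have "\<phi> 1 - \<phi> 0 = (\<Sum>k<N. \<phi> (real (Suc k) / N) - \<phi> (real k / N))"
      using sum_lessThan_telescope[of "\<lambda>k. \<phi> (real k / N)" N] assms(1) by simp
    then have "1 \<le> (\<Sum>k<N. \<bar>\<phi> (real (Suc k) / N) - \<phi> (real k / N)\<bar>)"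
      using assms(3) sum_abs[of "\<lambda>k. \<phi> (real (Suc k) / N) - \<phi> (real k / N)" "{..<N}"] by linarith
    also have "\<dots> \<le> (\<Sum>k<N. min 1 (2 * r k))"
    proof (rule sum_mono)
      fix k assume "k \<in> {..<N}"
      then have k: "k < N" by simp
      have "r k \<le> min 1 (2 * r k)" using True k r[OF k] by auto
      then show "\<bar>\<phi> (real (Suc k) / N) - \<phi> (real k / N)\<bar> \<le> min 1 (2 * r k)"
        using step[OF k] by linarith
    qed
    finally show ?thesis .
  qed
qed

section \<open>Grids of unit cells\<close>

definition cells :: "('n::finite \<Rightarrow> nat) \<Rightarrow> ('n \<Rightarrow> nat) set" where
  "cells N = {k. \<forall>j. k j < N j}"

lemma cells_eq_PiE: "cells N = (\<Pi>\<^sub>E j\<in>UNIV. {..<N j})"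
  by (auto simp: cells_def PiE_UNIV_domain)

lemma finite_cells: "finite (cells N)"
  unfolding cells_eq_PiE by (intro finite_PiE) auto

lemma card_cells: "card (cells N) = (\<Prod>j\<in>UNIV. N j)"
  unfolding cells_eq_PiE by (simp add: card_PiE)

lemma sum_cells_by_lines:
  "sum g (cells N) = (\<Sum>k\<in>{k \<in> cells N. k i = 0}. \<Sum>j<N i. g (k(i := j)))"
proof -
  have "(\<Sum>k\<in>{k \<in> cells N. k i = 0}. \<Sum>j<N i. g (k(i := j)))
      = (\<Sum>(k, j)\<in>{k \<in> cells N. k i = 0} \<times> {..<N i}. g (k(i := j)))"
    by (simp add: sum.cartesian_product)
  also have "\<dots> = sum g (cells N)"
    by (rule sum.reindex_bij_witness[of _ "\<lambda>k. (k(i := 0), k i)" "\<lambda>(k, j). k(i := j)"])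
      (auto simp: cells_def fun_eq_iff, metis gr_zeroI not_less_zero)
  finally show ?thesis ..
qed

lemma card_lines:
  "card {k \<in> cells N. k i = 0} * N i = card (cells N)"
  using sum_cells_by_lines[of "\<lambda>_. 1 :: nat" N i] by (simp add: finite_cells)

text \<open>The number of unit steps around the circle in direction \<open>j\<close> at height \<open>t\<close>. For negative heights it is 1,
the circles being shorter than one unit.\<close>

definition grid_size :: "('n \<Rightarrow> real) \<Rightarrow> real \<Rightarrow> 'n \<Rightarrow> nat" where
  "grid_size \<mu> t j = nat \<lceil>exp (\<mu> j * t)\<rceil>"

lemma grid_size_ge: "exp (\<mu> j * t) \<le> real (grid_size \<mu> t j)"
  unfolding grid_size_def by linarith

lemma grid_size_pos: "0 < grid_size \<mu> t j"
  by (simp add: grid_size_def)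

lemma grid_size_le:
  assumes "0 \<le> \<mu> j" "0 \<le> t"
  shows "real (grid_size \<mu> t j) \<le> 2 * exp (\<mu> j * t)"
proof -
  have "1 \<le> exp (\<mu> j * t)" using assms by simp
  moreover have "real (grid_size \<mu> t j) \<le> exp (\<mu> j * t) + 1"
    unfolding grid_size_def using of_int_ceiling_le_add_one[of "exp (\<mu> j * t)"]
    by (subst of_nat_nat) (auto intro: less_trans[of _ 0])
  ultimately show ?thesis by linarith
qed

lemma grid_size_nonpos:
  assumes "0 \<le> \<mu> j" "t \<le> 0"
  shows "grid_size \<mu> t j = 1"
proof -
  have "exp (\<mu> j * t) \<le> 1" using assms by (simp add: mult_nonneg_nonpos)
  then have "\<lceil>exp (\<mu> j * t)\<rceil> = 1"
    by (intro ceiling_unique) auto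
  then show ?thesis by (simp add: grid_size_def)
qed

definition grid_point :: "('n::finite \<Rightarrow> real) \<Rightarrow> real \<Rightarrow> ('n \<Rightarrow> nat) \<Rightarrow> (real ^ 'n) \<times> real" where
  "grid_point \<mu> t k = ((\<chi> j. real (k j) / real (grid_size \<mu> t j)), t)"

lemma card_integers_near:
  fixes c \<rho> :: real
  assumes "0 \<le> \<rho>"
  shows "real (card {\<lceil>c - \<rho>\<rceil>..\<lfloor>c + \<rho>\<rfloor>}) \<le> 2 * \<rho> + 1"
proof (cases "\<lceil>c - \<rho>\<rceil> \<le> \<lfloor>c + \<rho>\<rfloor> + 1")
  case True
  then have "real (card {\<lceil>c - \<rho>\<rceil>..\<lfloor>c + \<rho>\<rfloor>}) = of_int (\<lfloor>c + \<rho>\<rfloor> - \<lceil>c - \<rho>\<rceil> + 1)" by simp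
  also have "\<dots> \<le> 2 * \<rho> + 1" by linarith
  finally show ?thesis .
qed (use assms in simp)

text \<open>Every such \<open>k\<close> is the residue modulo \<open>N\<close> of an integer in the interval around \<open>c\<close> of radius \<open>\<rho>\<close>.\<close>

lemma card_residues_near:
  fixes c \<rho> :: real
  assumes "0 < N" "0 \<le> \<rho>"
  shows "real (card {k::nat. k < N \<and> (\<exists>v\<in>\<int>. \<bar>real k - (c + real N * v)\<bar> \<le> \<rho>)}) \<le> 2 * \<rho> + 1"
proof -
  let ?A = "{k::nat. k < N \<and> (\<exists>v\<in>\<int>. \<bar>real k - (c + real N * v)\<bar> \<le> \<rho>)}"
  let ?I = "{\<lceil>c - \<rho>\<rceil>..\<lfloor>c + \<rho>\<rfloor>}"
  have "?A \<subseteq> (\<lambda>z. nat (z mod int N)) ` ?I"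
  proof
    fix k assume "k \<in> ?A"
    then obtain v where k: "k < N" and v: "v \<in> \<int>" "\<bar>real k - (c + real N * v)\<bar> \<le> \<rho>" by blast
    from v(1) obtain z :: int where z: "v = of_int z" by (rule Ints_cases)
    let ?y = "int k - int N * z"
    have "real_of_int ?y = real k - real N * v" by (simp add: z)
    with v(2) have "c - \<rho> \<le> real_of_int ?y" "real_of_int ?y \<le> c + \<rho>" by (auto simp: abs_le_iff)
    then have "?y \<in> ?I" by (simp add: ceiling_le_iff le_floor_iff)
    moreover have "k = nat (?y mod int N)"
      using k by (simp add: mod_diff_eq[symmetric] del: mod_diff_eq) 
    ultimately show "k \<in> (\<lambda>z. nat (z mod int N)) ` ?I" by blast
  qed
  then have "card ?A \<le> card ?I"
    by (meson card_image_le card_mono finite_atLeastAtMost_int finite_imageI le_trans)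
  with card_integers_near[OF assms(2), of c] show ?thesis by linarith
qed

lemma card_nats_near:
  fixes c \<rho> :: real
  assumes "0 \<le> \<rho>"
  shows "finite {t::nat. \<bar>real t - c\<bar> \<le> \<rho>}" "real (card {t::nat. \<bar>real t - c\<bar> \<le> \<rho>}) \<le> 2 * \<rho> + 1"
proof -
  let ?I = "{\<lceil>c - \<rho>\<rceil>..\<lfloor>c + \<rho>\<rfloor>}"
  have "{t::nat. \<bar>real t - c\<bar> \<le> \<rho>} \<subseteq> nat ` ?I"
  proof
    fix t :: nat assume "t \<in> {t. \<bar>real t - c\<bar> \<le> \<rho>}"
    then have "int t \<in> ?I" by (simp add: ceiling_le_iff le_floor_iff abs_le_iff)
    then show "t \<in> nat ` ?I" by (metis image_eqI nat_int)
  qed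
  then show "finite {t::nat. \<bar>real t - c\<bar> \<le> \<rho>}"
    by (rule finite_subset) simp
  from \<open>_ \<subseteq> nat ` ?I\<close> have "card {t::nat. \<bar>real t - c\<bar> \<le> \<rho>} \<le> card ?I"
    by (rule surj_card_le[rotated]) simp
  with card_integers_near[OF assms, of c]
  show "real (card {t::nat. \<bar>real t - c\<bar> \<le> \<rho>}) \<le> 2 * \<rho> + 1" by linarith
qed

text \<open>The metric has bounded geometry: near \<open>z\<close> there are at most \<open>2 L + 1\<close> heights, and at each of them the
displacement estimate leaves boundedly many grid steps in every direction.\<close>

lemma card_close_grid_points:
  fixes \<mu> :: "'n::finite \<Rightarrow> real"
  assumes \<mu>: "\<forall>i. 0 \<le> \<mu> i \<and> \<mu> i \<le> a" and "0 \<le> L"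
  shows "real (card {(t, k). t \<le> (T::nat) \<and> k \<in> cells (grid_size \<mu> t) \<and>
      torus_dist \<mu> (torus_proj (grid_point \<mu> t k)) (torus_proj z) < L})
    \<le> (2 * L + 1) * (4 * L * exp (a * L) + 1) ^ CARD('n)" (is "real (card ?A) \<le> _")
proof -
  let ?\<rho> = "2 * L * exp (a * L)"
  let ?N = "\<lambda>t::nat. grid_size \<mu> (real t)"
  define Ts where "Ts = {t::nat. \<bar>real t - snd z\<bar> \<le> L}"
  define J where "J t j = {k::nat. k < ?N t j \<and>
      (\<exists>v\<in>\<int>. \<bar>real k - (real (?N t j) * fst z $ j + real (?N t j) * v)\<bar> \<le> ?\<rho>)}" for t j
  have J: "finite (J t j)" "real (card (J t j)) \<le> 2 * ?\<rho> + 1" for t j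
    unfolding J_def using card_residues_near[OF grid_size_pos, of ?\<rho> \<mu> t j] \<open>0 \<le> L\<close> by auto
  have Ts: "finite Ts" "real (card Ts) \<le> 2 * L + 1"
    unfolding Ts_def using card_nats_near[OF \<open>0 \<le> L\<close>] by auto
  have sub: "?A \<subseteq> (SIGMA t:Ts. \<Pi>\<^sub>E j\<in>UNIV. J t j)"
  proof clarify
    fix t :: nat and k
    assume k: "k \<in> cells (grid_size \<mu> t)"
      and d: "torus_dist \<mu> (torus_proj (grid_point \<mu> t k)) (torus_proj z) < L"
    have "\<forall>i. 0 \<le> \<mu> i" using \<mu> by blast
    then obtain v where v: "integer_vec v" "\<bar>snd z - snd (grid_point \<mu> t k)\<bar> \<le> L"
      "\<And>j. \<bar>fst z $ j + v $ j - fst (grid_point \<mu> t k) $ j\<bar> \<le> L * exp (\<mu> j * (L - snd (grid_point \<mu> t k)))"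
      using torus_dist_displacement[OF _ d] by blast
    have "t \<in> Ts" using v(2) by (simp add: Ts_def grid_point_def abs_minus_commute)
    moreover have "k j \<in> J t j" for j
    proof -
      let ?M = "real (?N t j)"
      have "?M > 0" using grid_size_pos by simp
      have "\<bar>real (k j) - (?M * fst z $ j + ?M * v $ j)\<bar> = ?M * \<bar>fst z $ j + v $ j - real (k j) / ?M\<bar>"
      proof -
        have "?M * \<bar>fst z $ j + v $ j - real (k j) / ?M\<bar> = \<bar>?M * (fst z $ j + v $ j - real (k j) / ?M)\<bar>"
          by (simp add: abs_mult)
        also have "?M * (fst z $ j + v $ j - real (k j) / ?M) = - (real (k j) - (?M * fst z $ j + ?M * v $ j))"
          using \<open>?M > 0\<close> by (simp add: algebra_simps)
        finally show ?thesis by simp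
      qed
      also have "\<dots> \<le> (2 * exp (\<mu> j * t)) * (L * exp (\<mu> j * (L - t)))"
        using v(3)[of j] grid_size_le[of \<mu> j "real t"] \<mu> \<open>0 \<le> L\<close>
        by (intro mult_mono) (auto simp: grid_point_def)
      also have "\<dots> = 2 * L * exp (\<mu> j * L)"
        by (simp add: right_diff_distrib exp_diff)
      also have "\<dots> \<le> ?\<rho>"
        using \<mu> \<open>0 \<le> L\<close> by (intro mult_left_mono) (auto intro: mult_right_mono)
      finally show ?thesis
        using v(1) k unfolding J_def cells_def integer_vec_def by blast
    qed
    ultimately show "t \<in> Ts \<and> k \<in> (\<Pi>\<^sub>E j\<in>UNIV. J t j)" by (simp add: PiE_UNIV_domain)
  qed
  have fin: "finite (SIGMA t:Ts. \<Pi>\<^sub>E j\<in>UNIV. J t j)"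
    using Ts J by (intro finite_SigmaI finite_PiE) auto
  have "real (card ?A) \<le> real (card (SIGMA t:Ts. \<Pi>\<^sub>E j\<in>UNIV. J t j))"
    using card_mono[OF fin sub] by simp
  also have "\<dots> = (\<Sum>t\<in>Ts. real (\<Prod>j\<in>UNIV. card (J t j)))"
    using Ts J by (subst card_SigmaI) (auto intro: finite_PiE simp: card_PiE)
  also have "\<dots> \<le> (\<Sum>t\<in>Ts. (2 * ?\<rho> + 1) ^ CARD('n))"
  proof (rule sum_mono)
    fix t
    have "(\<Prod>j\<in>UNIV. real (card (J t j))) \<le> (\<Prod>j\<in>(UNIV::'n set). 2 * ?\<rho> + 1)"
      using J by (intro prod_mono) auto
    then show "real (\<Prod>j\<in>UNIV. card (J t j)) \<le> (2 * ?\<rho> + 1) ^ CARD('n)" by simp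
  qed
  also have "\<dots> = real (card Ts) * (2 * ?\<rho> + 1) ^ CARD('n)" by simp
  also have "\<dots> \<le> (2 * L + 1) * (2 * ?\<rho> + 1) ^ CARD('n)"
    using Ts(2) \<open>0 \<le> L\<close> by (intro mult_right_mono) auto
  finally show ?thesis by (simp add: mult.assoc)
qed

section \<open>Unit boxes in the target\<close>

text \<open>The integer part of the height, and the position of the point in the grid at that height. Taking
fractional parts makes the index depend only on the projection of \<open>p\<close> to the quotient.\<close>

definition box_index :: "('n \<Rightarrow> real) \<Rightarrow> (real ^ 'n) \<times> real \<Rightarrow> int \<times> ('n \<Rightarrow> nat)" where
  "box_index \<mu> p = (\<lfloor>snd p\<rfloor>, \<lambda>j. nat \<lfloor>frac (fst p $ j) * grid_size \<mu> \<lfloor>snd p\<rfloor> j\<rfloor>)"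

lemma box_index_in_cells: "snd (box_index \<mu> p) \<in> cells (grid_size \<mu> (fst (box_index \<mu> p)))"
proof -
  have "nat \<lfloor>frac x * real N\<rfloor> < N" if "0 < N" for x :: real and N
  proof -
    have "frac x * real N < 1 * real N" using that frac_lt_1 by (intro mult_strict_right_mono) auto
    then have "\<lfloor>frac x * real N\<rfloor> < int N" by (simp add: floor_less_iff)
    with that show ?thesis by linarith
  qed
  then show ?thesis by (simp add: box_index_def cells_def grid_size_pos)
qed

lemma same_box_close:
  fixes \<mu> :: "'n::finite \<Rightarrow> real"
  assumes \<mu>: "\<forall>i. 0 \<le> \<mu> i \<and> \<mu> i \<le> a" and eq: "box_index \<mu> p = box_index \<mu> q"
  shows "torus_dist \<mu> (torus_proj p) (torus_proj q) \<le> 1 + CARD('n) * exp a"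
proof -
  let ?m = "\<lfloor>snd p\<rfloor>"
  define red where "red p = ((\<chi> j. frac (fst p $ j)), snd p)" for p :: "(real ^ 'n) \<times> real"
  have red: "torus_proj (red p) = torus_proj p" for p
    by (auto simp: torus_proj_eq_iff red_def frac_def)
  have m: "\<lfloor>snd q\<rfloor> = ?m" using eq by (simp add: box_index_def)
  have ht: "snd p \<le> ?m + 1" "snd q \<le> ?m + 1" "\<bar>snd q - snd p\<bar> \<le> 1" using m by linarith+
  have "exp (\<mu> j * (?m + 1)) * \<bar>fst (red q) $ j - fst (red p) $ j\<bar> \<le> exp a" for j
  proof -
    let ?N = "real (grid_size \<mu> ?m j)"
    have "?N > 0" using grid_size_pos by simp
    have "nat \<lfloor>frac (fst p $ j) * ?N\<rfloor> = nat \<lfloor>frac (fst q $ j) * ?N\<rfloor>"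
      using eq m by (simp add: box_index_def fun_eq_iff)
    then have "\<lfloor>frac (fst p $ j) * ?N\<rfloor> = \<lfloor>frac (fst q $ j) * ?N\<rfloor>"
      by (simp add: nat_eq_iff)
    then have "\<bar>frac (fst q $ j) * ?N - frac (fst p $ j) * ?N\<bar> \<le> 1" by linarith
    then have "\<bar>(frac (fst q $ j) - frac (fst p $ j)) * ?N\<bar> \<le> 1" by (simp add: algebra_simps)
    then have *: "?N * \<bar>frac (fst q $ j) - frac (fst p $ j)\<bar> \<le> 1"
      by (simp add: abs_mult mult.commute)
    have "exp (\<mu> j * ?m) * \<bar>frac (fst q $ j) - frac (fst p $ j)\<bar> \<le> ?N * \<bar>frac (fst q $ j) - frac (fst p $ j)\<bar>"
      using grid_size_ge by (intro mult_right_mono) auto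
    also note *
    finally have "exp (\<mu> j) * (exp (\<mu> j * ?m) * \<bar>frac (fst q $ j) - frac (fst p $ j)\<bar>) \<le> exp a * 1"
      using \<mu> by (intro mult_mono) auto
    then show ?thesis by (simp add: red_def distrib_left exp_add mult_ac)
  qed
  then have "(\<Sum>j\<in>UNIV. exp (\<mu> j * (?m + 1)) * \<bar>fst (red q) $ j - fst (red p) $ j\<bar>)
      \<le> CARD('n) * exp a"
    using sum_bounded_above[of UNIV _ "exp a"] by force
  moreover have "torus_dist \<mu> (torus_proj (red p)) (torus_proj (red q)) \<le> \<bar>snd (red q) - snd (red p)\<bar>
      + (\<Sum>j\<in>UNIV. exp (\<mu> j * (?m + 1)) * \<bar>fst (red q) $ j - fst (red p) $ j\<bar>)"
    by (rule torus_dist_le_line) (use \<mu> ht in \<open>auto simp: red_def\<close>)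
  moreover have "snd (red q) - snd (red p) = snd q - snd p" by (simp add: red_def)
  ultimately show ?thesis using ht(3) unfolding red by linarith
qed

text \<open>The sum is organised by the boxes that contain the points \<open>F \<sigma>\<close>. The exponent \<open>p\<close> is chosen so that
\<open>p * \<mu> n\<close> is the growth rate of the number of boxes; hence the boxes of one level, each with at most \<open>M\<close>
points, contribute a bounded amount, whatever the level.\<close>

lemma weight_sum_upper_bound:
  fixes \<mu> :: "'n::finite \<Rightarrow> real" and F :: "'x \<Rightarrow> (real ^ 'n) \<times> real" and M H E p :: real
  assumes \<mu>: "\<forall>i. 0 < \<mu> i \<and> \<mu> i \<le> \<mu> n" and "1 \<le> E" "0 \<le> M" "0 \<le> H" and p: "p = (\<Sum>i\<in>UNIV. \<mu> i) / \<mu> n"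
    and "finite S" and ht: "\<And>\<sigma>. \<sigma> \<in> S \<Longrightarrow> \<bar>snd (F \<sigma>)\<bar> \<le> H"
    and mult: "\<And>\<sigma>. \<sigma> \<in> S \<Longrightarrow> real (card {\<tau> \<in> S. box_index \<mu> (F \<tau>) = box_index \<mu> (F \<sigma>)}) \<le> M"
  shows "(\<Sum>\<sigma>\<in>S. (min 1 (E * exp (- \<mu> n * snd (F \<sigma>)))) powr p) \<le> (2 * H + 2) * (M * (2 * E) ^ CARD('n))"
proof -
  let ?h = "\<Sum>i\<in>UNIV. \<mu> i"
  let ?I = "{\<lfloor>- H\<rfloor>..\<lfloor>H\<rfloor>}"
  let ?K = "SIGMA m:?I. cells (grid_size \<mu> (of_int m))"
  define w where "w \<tau> = (min 1 (E * exp (- \<mu> n * \<tau>))) powr p" for \<tau>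
  have n: "0 < \<mu> n" using \<mu> by blast
  have h: "0 \<le> ?h" by (rule sum_nonneg) (use \<mu> in \<open>auto intro: less_imp_le\<close>)
  have "?h \<le> (\<Sum>i\<in>(UNIV::'n set). \<mu> n)" using \<mu> by (intro sum_mono) auto
  then have p': "0 \<le> p" "p \<le> CARD('n)" "p * \<mu> n = ?h"
    using n h by (auto simp: p field_simps)
  have w_mono: "w \<tau> \<le> w \<tau>'" if "\<tau>' \<le> \<tau>" for \<tau> \<tau>'
  proof -
    have "E * exp (- \<mu> n * \<tau>) \<le> E * exp (- \<mu> n * \<tau>')"
      using that n \<open>1 \<le> E\<close> by (intro mult_left_mono) auto
    then show ?thesis
      unfolding w_def using p'(1) \<open>1 \<le> E\<close> by (intro powr_mono2 min.mono) auto
  qed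
  have w_nonneg: "0 \<le> w \<tau>" for \<tau> by (simp add: w_def)
  \<comment> \<open>The number of boxes and their weight balance at every height.\<close>
  have level: "card (cells (grid_size \<mu> m)) * w m \<le> (2 * E) ^ CARD('n)" for m :: real
  proof (cases "0 \<le> m")
    case True
    have "real (card (cells (grid_size \<mu> m))) = (\<Prod>j\<in>UNIV. real (grid_size \<mu> m j))"
      by (simp add: card_cells)
    also have "\<dots> \<le> (\<Prod>j\<in>UNIV. 2 * exp (\<mu> j * m))"
      using \<mu> True by (intro prod_mono) (auto intro!: grid_size_le intro: less_imp_le)
    also have "\<dots> = 2 ^ CARD('n) * exp (?h * m)"
      by (simp add: prod.distrib exp_sum sum_distrib_right)
    finally have c: "real (card (cells (grid_size \<mu> m))) \<le> 2 ^ CARD('n) * exp (?h * m)" .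
    have "w m \<le> (E * exp (- \<mu> n * m)) powr p"
      unfolding w_def using p' \<open>1 \<le> E\<close> by (intro powr_mono2) auto
    also have "\<dots> = E powr p * exp (- (?h * m))"
      using \<open>1 \<le> E\<close> p'(3) by (simp add: powr_mult exp_powr_real mult_ac flip: p'(3))
    also have "\<dots> \<le> E powr CARD('n) * exp (- (?h * m))"
      using \<open>1 \<le> E\<close> p' by (intro mult_right_mono powr_mono) auto
    also have "E powr CARD('n) = E ^ CARD('n)" using \<open>1 \<le> E\<close> by (simp add: powr_realpow)
    finally have "card (cells (grid_size \<mu> m)) * w m
        \<le> (2 ^ CARD('n) * exp (?h * m)) * (E ^ CARD('n) * exp (- (?h * m)))"
      using c w_nonneg by (intro mult_mono) auto
    also have "\<dots> = (2 * E) ^ CARD('n)" by (simp add: power_mult_distrib exp_minus)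
    finally show ?thesis .
  next
    case False
    then have "card (cells (grid_size \<mu> m)) = 1"
      using \<mu> by (simp add: card_cells grid_size_nonpos less_imp_le)
    moreover have "w m \<le> 1"
      unfolding w_def using p'(1) \<open>1 \<le> E\<close> by (intro powr_le1) auto
    moreover have "1 \<le> (2 * E) ^ CARD('n)" using \<open>1 \<le> E\<close> by (intro one_le_power) simp
    ultimately show ?thesis by simp
  qed
  have "(\<Sum>\<sigma>\<in>S. w (snd (F \<sigma>))) = (\<Sum>y\<in>?K. \<Sum>\<sigma>\<in>{\<sigma> \<in> S. box_index \<mu> (F \<sigma>) = y}. w (snd (F \<sigma>)))"
  proof (rule sum.group[symmetric, OF \<open>finite S\<close>])
    show "finite ?K" by (intro finite_SigmaI finite_cells) auto
    show "(\<lambda>\<sigma>. box_index \<mu> (F \<sigma>)) ` S \<subseteq> ?K"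
    proof
      fix y assume "y \<in> (\<lambda>\<sigma>. box_index \<mu> (F \<sigma>)) ` S"
      then obtain \<sigma> where \<sigma>: "\<sigma> \<in> S" "y = box_index \<mu> (F \<sigma>)" by blast
      have "fst y = \<lfloor>snd (F \<sigma>)\<rfloor>" by (simp add: \<sigma> box_index_def)
      moreover have "\<lfloor>snd (F \<sigma>)\<rfloor> \<in> ?I" using ht[OF \<sigma>(1)] by (auto intro!: floor_mono)
      moreover have "snd y \<in> cells (grid_size \<mu> (fst y))" unfolding \<sigma> by (rule box_index_in_cells)
      ultimately show "y \<in> ?K" by (metis SigmaI prod.collapse)
    qed
  qed
  also have "\<dots> \<le> (\<Sum>y\<in>?K. M * w (fst y))"
  proof (rule sum_mono)
    fix y assume "y \<in> ?K"
    show "(\<Sum>\<sigma>\<in>{\<sigma> \<in> S. box_index \<mu> (F \<sigma>) = y}. w (snd (F \<sigma>))) \<le> M * w (fst y)"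
    proof (cases "\<exists>\<sigma>\<in>S. box_index \<mu> (F \<sigma>) = y")
      case True
      have "(\<Sum>\<sigma>\<in>{\<sigma> \<in> S. box_index \<mu> (F \<sigma>) = y}. w (snd (F \<sigma>)))
          \<le> (\<Sum>\<sigma>\<in>{\<sigma> \<in> S. box_index \<mu> (F \<sigma>) = y}. w (fst y))"
        by (intro sum_mono w_mono) (auto simp: box_index_def)
      also have "\<dots> = card {\<sigma> \<in> S. box_index \<mu> (F \<sigma>) = y} * w (fst y)" by simp
      also have "\<dots> \<le> M * w (fst y)"
        using True mult w_nonneg by (intro mult_right_mono) auto
      finally show ?thesis .
    next
      case False
      then have "{\<sigma> \<in> S. box_index \<mu> (F \<sigma>) = y} = {}" by blast
      then show ?thesis using \<open>0 \<le> M\<close> w_nonneg by (simp only: sum.empty) simp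
    qed
  qed
  also have "\<dots> = (\<Sum>m\<in>?I. \<Sum>k\<in>cells (grid_size \<mu> (of_int m)). M * w m)"
    by (subst sum.Sigma) (auto simp: finite_cells split_def)
  also have "\<dots> = (\<Sum>m\<in>?I. M * (card (cells (grid_size \<mu> (of_int m))) * w m))"
    by (simp add: mult_ac)
  also have "\<dots> \<le> (\<Sum>m\<in>?I. M * (2 * E) ^ CARD('n))"
    using level \<open>0 \<le> M\<close> by (intro sum_mono mult_left_mono) auto
  also have "\<dots> = card ?I * (M * (2 * E) ^ CARD('n))" by simp
  also have "\<dots> \<le> (2 * H + 2) * (M * (2 * E) ^ CARD('n))"
  proof (rule mult_right_mono)
    have "- 1 \<le> \<lfloor>H\<rfloor> - \<lfloor>- H\<rfloor>" using \<open>0 \<le> H\<close> by linarith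
    then have "real (card ?I) = of_int (\<lfloor>H\<rfloor> - \<lfloor>- H\<rfloor> + 1)" by simp
    also have "\<dots> \<le> 2 * H + 2" by linarith
    finally show "real (card ?I) \<le> 2 * H + 2" .
  qed (use \<open>0 \<le> M\<close> \<open>1 \<le> E\<close> in auto)
  finally show ?thesis by (simp add: w_def)
qed

section \<open>Weights on the slices of the source\<close>

text \<open>The \<open>k\<close>-th coordinate of the lift \<open>F\<close>, followed along the circle through \<open>p\<close> in direction \<open>i\<close>, changes
by the nonzero integer \<open>u $ k\<close>. Consecutive grid points are at distance at most 1, so \<open>coarse\<close> and the
displacement estimate bound every step modulo integers.\<close>

lemma grid_line_weight_ge_1:
  fixes \<mu> \<mu>' :: "'n::finite \<Rightarrow> real"
  assumes \<mu>: "\<forall>i. 0 \<le> \<mu> i" and \<mu>': "\<forall>i. 0 \<le> \<mu>' i"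
    and F: "continuous_on {p. 0 \<le> snd p \<and> snd p \<le> T} F"
    and period: "\<And>p. 0 \<le> snd p \<Longrightarrow> snd p \<le> T \<Longrightarrow> F (p + (axis i 1, 0)) = F p + (u, 0)"
    and u: "integer_vec u" "u $ k \<noteq> 0"
    and coarse: "\<And>p q. 0 \<le> snd p \<Longrightarrow> snd p \<le> T \<Longrightarrow> snd q = snd p \<Longrightarrow>
        torus_dist \<mu> (torus_proj p) (torus_proj q) \<le> 1 \<Longrightarrow>
        torus_dist \<mu>' (torus_proj (F p)) (torus_proj (F q)) < L"
    and p: "0 \<le> snd p" "snd p \<le> T"
  defines "N \<equiv> grid_size \<mu> (snd p) i"
  shows "1 \<le> (\<Sum>j<N. min 1 (2 * (L * exp (\<mu>' k * (L - snd (F (p + ((real j / N) *\<^sub>R axis i 1, 0))))))))"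
proof -
  let ?z = "\<lambda>s. p + (s *\<^sub>R axis i 1, 0) :: (real ^ 'n) \<times> real"
  define \<phi> where "\<phi> s = fst (F (?z s)) $ k" for s
  have N: "0 < N" unfolding N_def by (rule grid_size_pos)
  show ?thesis
  proof (rule circuit_weight_ge_1[OF N])
    have "continuous_on {0..1} (\<lambda>s. F (?z s))"
      by (rule continuous_on_compose2[OF F]) (use p in \<open>auto intro!: continuous_intros\<close>)
    then show "continuous_on {0..1} \<phi>" unfolding \<phi>_def by (intro continuous_intros)
    have "\<phi> 1 - \<phi> 0 = u $ k" using period[OF p] by (simp add: \<phi>_def zero_prod_def[symmetric])
    then show "1 \<le> \<bar>\<phi> 1 - \<phi> 0\<bar>"
      using u Ints_nonzero_abs_ge1 by (auto simp: integer_vec_def)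
  next
    fix j s assume j: "j < N" and s: "real j / N \<le> s" "s \<le> (real j + 1) / N"
    have "torus_dist \<mu> (torus_proj (?z (real j / N))) (torus_proj (?z s)) \<le>
        \<bar>snd (?z s) - snd (?z (real j / N))\<bar> +
        (\<Sum>l\<in>UNIV. exp (\<mu> l * snd p) * \<bar>fst (?z s) $ l - fst (?z (real j / N)) $ l\<bar>)"
      by (rule torus_dist_le_line[OF \<mu>]) auto
    also have "\<dots> = (\<Sum>l\<in>UNIV. if l = i then exp (\<mu> i * snd p) * \<bar>s - real j / N\<bar> else 0)"
    proof -
      have "fst (?z s) $ l - fst (?z (real j / N)) $ l = (if l = i then s - real j / N else 0)" for l
        by (simp add: axis_def)
      then have "\<bar>snd (?z s) - snd (?z (real j / N))\<bar> +
        (\<Sum>l\<in>UNIV. exp (\<mu> l * snd p) * \<bar>fst (?z s) $ l - fst (?z (real j / N)) $ l\<bar>)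
        = (\<Sum>l\<in>UNIV. exp (\<mu> l * snd p) * \<bar>if l = i then s - real j / N else 0\<bar>)"
        by (simp only:) simp
      also have "\<dots> = (\<Sum>l\<in>UNIV. if l = i then exp (\<mu> i * snd p) * \<bar>s - real j / N\<bar> else 0)"
        by (intro sum.cong) auto
      finally show ?thesis .
    qed
    also have "\<dots> = exp (\<mu> i * snd p) * (s - real j / N)" using s by simp
    also have "\<dots> \<le> N * (1 / N)"
    proof (rule mult_mono)
      show "exp (\<mu> i * snd p) \<le> N" unfolding N_def by (rule grid_size_ge)
    qed (use s in \<open>auto simp: add_divide_distrib\<close>)
    also have "\<dots> = 1" using N by simp
    finally have "torus_dist \<mu>' (torus_proj (F (?z (real j / N)))) (torus_proj (F (?z s))) < L"
      by (intro coarse) (use p in auto)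
    then obtain v where v: "integer_vec v"
      "\<And>l. \<bar>fst (F (?z s)) $ l + v $ l - fst (F (?z (real j / N))) $ l\<bar>
          \<le> L * exp (\<mu>' l * (L - snd (F (?z (real j / N)))))"
      using torus_dist_displacement[OF \<mu>'] by blast
    show "\<exists>m\<in>\<int>. \<bar>\<phi> s - \<phi> (real j / N) - m\<bar> \<le> L * exp (\<mu>' k * (L - snd (F (?z (real j / N)))))"
      using v(1) v(2)[of k] by (intro bexI[of _ "- v $ k"]) (auto simp: \<phi>_def integer_vec_def algebra_simps)
  qed
qed

text \<open>The slice is a disjoint union of grid lines in direction \<open>i\<close>, to each of which the power mean inequality
applies. Only \<open>\<mu> i \<le> \<nu>\<close> is known about the direction \<open>i\<close>, and it suffices because shorter lines
give larger sums.\<close>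

lemma slice_sum_lower_bound:
  fixes \<mu> :: "'n::finite \<Rightarrow> real" and t p \<nu> :: real
  assumes \<mu>: "\<forall>i. 0 \<le> \<mu> i \<and> \<mu> i \<le> \<nu>" and "0 \<le> t" and p: "1 \<le> p" "p \<le> CARD('n)"
    and w: "\<And>q. 0 \<le> w q"
    and line: "\<And>q. snd q = t \<Longrightarrow>
      1 \<le> (\<Sum>j<grid_size \<mu> t i. w (q + ((real j / grid_size \<mu> t i) *\<^sub>R axis i 1, 0)))"
  shows "exp (((\<Sum>i\<in>UNIV. \<mu> i) - p * \<nu>) * t) \<le> 2 ^ CARD('n) * (\<Sum>k\<in>cells (grid_size \<mu> t). w (grid_point \<mu> t k) powr p)"
proof -
  let ?N = "grid_size \<mu> t"
  let ?h = "\<Sum>i\<in>UNIV. \<mu> i"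
  let ?B = "{k \<in> cells ?N. k i = 0}"
  have N: "0 < ?N i" by (rule grid_size_pos)
  have "exp ((?h - p * \<nu>) * t) \<le> exp ((?h - p * \<mu> i) * t)"
    using \<mu> \<open>0 \<le> t\<close> p by (auto intro!: mult_right_mono)
  also have "\<dots> = exp (?h * t) * exp (\<mu> i * t) powr - p"
    by (simp add: exp_powr_real algebra_simps flip: exp_add)
  also have "\<dots> = 2 powr p * (exp (?h * t) * (2 * exp (\<mu> i * t)) powr - p)"
    by (simp add: powr_mult powr_minus)
  also have "\<dots> \<le> 2 powr CARD('n) * (card (cells ?N) * real (?N i) powr - p)"
  proof (intro mult_mono powr_mono)
    have "exp (?h * t) = (\<Prod>j\<in>UNIV. exp (\<mu> j * t))"
      by (simp add: exp_sum sum_distrib_right)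
    also have "\<dots> \<le> (\<Prod>j\<in>UNIV. real (?N j))"
      by (intro prod_mono) (auto intro: grid_size_ge)
    finally show "exp (?h * t) \<le> real (card (cells ?N))" by (simp add: card_cells)
    show "(2 * exp (\<mu> i * t)) powr - p \<le> real (?N i) powr - p"
      using grid_size_le[of \<mu> i t] N \<mu> \<open>0 \<le> t\<close> p by (intro powr_mono2') auto
  qed (use p in auto)
  also have "card (cells ?N) * real (?N i) powr - p = (\<Sum>k\<in>?B. real (?N i) powr (1 - p))"
    using N by (simp add: powr_diff powr_minus field_simps flip: card_lines[of ?N i])
  also have "\<dots> \<le> (\<Sum>k\<in>?B. \<Sum>j<?N i. w (grid_point \<mu> t (k(i := j))) powr p)"
  proof (rule sum_mono)
    fix k assume k: "k \<in> ?B"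
    have "grid_point \<mu> t (k(i := j)) = grid_point \<mu> t k + ((real j / ?N i) *\<^sub>R axis i 1, 0)" for j
      using k by (auto simp: grid_point_def vec_eq_iff axis_def)
    moreover have "snd (grid_point \<mu> t k) = t" by (simp add: grid_point_def)
    ultimately show "real (?N i) powr (1 - p) \<le> (\<Sum>j<?N i. w (grid_point \<mu> t (k(i := j))) powr p)"
      using line[of "grid_point \<mu> t k"] w by (intro power_mean_lower_bound[OF p(1) N]) auto
  qed
  also have "\<dots> = (\<Sum>k\<in>cells ?N. w (grid_point \<mu> t k) powr p)"
    by (rule sum_cells_by_lines[symmetric])
  finally show ?thesis by (simp add: powr_realpow)
qed

section \<open>Comparison of both sides\<close>

text \<open>Jensen's inequality: the linear terms of the tangents at the midpoint \<open>T / 2\<close> cancel. It keeps the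
factor \<open>T + 1\<close>, which is needed to absorb the number of levels on the target side when \<open>x\<close> is
small.\<close>

lemma exp_sum_ge_midpoint:
  fixes x :: real
  shows "(real T + 1) * exp (x * T / 2) \<le> (\<Sum>t\<le>T. exp (x * real t))"
proof -
  have gauss: "(\<Sum>t\<le>T. real t) = T * (T + 1) / 2"
    using gauss_sum_nat[of T] by (induction T) (auto simp: field_simps)
  have zero: "(\<Sum>t\<le>T. x * (real t - T / 2)) = 0"
    by (simp add: sum_subtractf gauss flip: sum_distrib_left) (simp add: field_simps)
  have card: "(\<Sum>t\<le>T. 1) = real T + 1" by simp
  have "(real T + 1) * exp (x * T / 2)
      = exp (x * T / 2) * ((\<Sum>t\<le>T. 1) + (\<Sum>t\<le>T. x * (real t - T / 2)))"
    unfolding zero card by (simp only: add_0_right mult.commute)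
  also have "\<dots> = (\<Sum>t\<le>T. exp (x * T / 2) * (1 + x * (real t - T / 2)))"
    by (simp only: sum_distrib_left flip: sum.distrib)
  also have "\<dots> \<le> (\<Sum>t\<le>T. exp (x * real t))"
  proof (rule sum_mono)
    fix t
    have "exp (x * T / 2) * (1 + x * (real t - T / 2)) \<le> exp (x * T / 2) * exp (x * (real t - T / 2))"
      by (intro mult_left_mono exp_ge_add_one_self) auto
    also have "\<dots> = exp (x * real t)" by (simp add: right_diff_distrib flip: exp_add)
    finally show "exp (x * T / 2) * (1 + x * (real t - T / 2)) \<le> exp (x * real t)" .
  qed
  finally show ?thesis .
qed

text \<open>Both estimates of the sum of \<open>w powr p\<close> over the grid points of the slices \<open>0, \<dots>, T\<close>. Here \<open>L\<close> strictly
bounds the distance between the images of points at distance at most 1, and \<open>L2\<close> the distance between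
points whose images share a box.\<close>

lemma embedding_exponential_sum_bound:
  fixes \<mu> \<mu>' :: "'n::finite \<Rightarrow> real" and a \<kappa> c R :: real and T :: nat
  assumes \<mu>: "\<forall>i. 0 < \<mu> i \<and> \<mu> i \<le> \<mu> n" "\<mu> n \<le> a"
    and \<mu>': "\<forall>i. 0 < \<mu>' i \<and> \<mu>' i \<le> \<mu>' n" "\<mu>' n \<le> a"
    and qi: "quasi_isometric_embedding_on (Metric_space.mball UNIV (torus_dist \<mu>) origin R) (torus_dist \<mu>)
        UNIV (torus_dist \<mu>') \<kappa> c f"
    and f0: "f origin = origin"
    and heq: "homotopy_equivalence_map
         (subtopology (torus_topology \<mu>) (Metric_space.mball UNIV (torus_dist \<mu>) origin R))
         (torus_topology \<mu>') f"
    and T: "T + CARD('n) < R"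
  defines "L \<equiv> \<kappa> + c + 1" and "L2 \<equiv> (1 + CARD('n) * exp a) * (\<kappa> + c) + 1"
  defines "h \<equiv> \<Sum>i\<in>UNIV. \<mu> i" and "p \<equiv> (\<Sum>i\<in>UNIV. \<mu>' i) / \<mu>' n"
  shows "(\<Sum>t\<le>T. exp ((h - p * \<mu> n) * real t)) \<le> 2 ^ CARD('n) * ((2 * (\<kappa> * R + c) + 2) *
    ((2 * L2 + 1) * (4 * L2 * exp (a * L2) + 1) ^ CARD('n) * (2 * (2 * L * exp (a * L))) ^ CARD('n)))"
proof -
  define B where "B = Metric_space.mball UNIV (torus_dist \<mu>) origin R"
  define D0 where "D0 = 1 + CARD('n) * exp a"
  define E where "E = 2 * L * exp (a * L)"
  define M where "M = (2 * L2 + 1) * (4 * L2 * exp (a * L2) + 1) ^ CARD('n)"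
  have \<mu>0: "\<forall>i. 0 \<le> \<mu> i" and \<mu>0': "\<forall>i. 0 \<le> \<mu>' i" using \<mu> \<mu>' by (auto intro: less_imp_le)
  have \<mu>a: "\<forall>i. 0 \<le> \<mu> i \<and> \<mu> i \<le> a" and \<mu>a': "\<forall>i. 0 \<le> \<mu>' i \<and> \<mu>' i \<le> a"
    using \<mu> \<mu>' by (auto intro: less_imp_le order_trans)
  have "0 < \<mu> n" "0 < \<mu>' n" using \<mu>(1) \<mu>'(1) by blast+
  then have "0 < a" using \<mu>(2) by linarith
  interpret X: Metric_space UNIV "torus_dist \<mu>" by (rule Metric_space_torus[OF \<mu>0])
  have B: "q \<in> B \<longleftrightarrow> torus_dist \<mu> origin q < R" for q by (simp add: B_def)
  have \<kappa>: "0 < \<kappa>" "0 \<le> c"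
    and up: "\<And>x y. x \<in> B \<Longrightarrow> y \<in> B \<Longrightarrow> torus_dist \<mu>' (f x) (f y) \<le> \<kappa> * torus_dist \<mu> x y + c"
    and low: "\<And>x y. x \<in> B \<Longrightarrow> y \<in> B \<Longrightarrow> 1 / \<kappa> * (torus_dist \<mu> x y - c) \<le> torus_dist \<mu>' (f x) (f y)"
    using qi unfolding quasi_isometric_embedding_on_def B_def by blast+
  have "1 \<le> D0" by (simp add: D0_def)
  have "1 \<le> L" "1 \<le> L2" "L2 = D0 * (\<kappa> + c) + 1"
    using \<kappa> \<open>1 \<le> D0\<close> by (auto simp: L_def L2_def D0_def)
  have "0 < R" using T by linarith
  have slabB: "torus_proj q \<in> B" if "0 \<le> snd q" "snd q \<le> real T" for q :: "(real ^ 'n) \<times> real"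
    using torus_dist_origin_le[OF \<mu>0, of q] that T by (simp add: B)
  obtain F :: "(real ^ 'n) \<times> real \<Rightarrow> (real ^ 'n) \<times> real" and W :: "real ^ 'n \<Rightarrow> real ^ 'n"
    where F: "continuous_on {p. 0 \<le> snd p \<and> snd p \<le> real T} F"
    and Fp: "\<And>p. 0 \<le> snd p \<Longrightarrow> snd p \<le> real T \<Longrightarrow> torus_proj (F p) = f (torus_proj p)"
    and W: "\<And>v. integer_vec v \<Longrightarrow> integer_vec (W v)"
    and FW: "\<And>p v. 0 \<le> snd p \<Longrightarrow> snd p \<le> real T \<Longrightarrow> integer_vec v \<Longrightarrow> F (p + (v, 0)) = F p + (W v, 0)"
    and Wnz: "\<And>k. \<exists>i. W (axis i 1) $ k \<noteq> 0"
    by (rule homotopy_equivalence_lift[OF \<mu>0 \<mu>0' _ slabB heq[folded B_def]]) auto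
  \<comment> \<open>\<open>i\<close> is a direction of the source whose circles wind around the \<open>n\<close>-th circle of the target.\<close>
  obtain i where i: "W (axis i 1) $ n \<noteq> 0" using Wnz by blast
  have ax: "integer_vec (axis i 1 :: real ^ 'n)" by (simp add: integer_vec_def axis_def)
  define w where "w q = min 1 (E * exp (- \<mu>' n * snd (F q)))" for q
  have "1 \<le> E"
  proof -
    have "1 * 1 \<le> 2 * L * exp (a * L)" using \<open>1 \<le> L\<close> \<open>0 < a\<close> by (intro mult_mono) auto
    then show ?thesis by (simp add: E_def)
  qed
  have w0: "0 \<le> w q" for q using \<open>1 \<le> E\<close> by (simp add: w_def)
  have p: "1 \<le> p" "p \<le> CARD('n)"
  proof -
    have "\<mu>' n \<le> (\<Sum>i\<in>UNIV. \<mu>' i)" using \<mu>0' by (intro member_le_sum) auto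
    then show "1 \<le> p" using \<open>0 < \<mu>' n\<close> by (simp add: p_def field_simps)
    have "(\<Sum>i\<in>UNIV. \<mu>' i) \<le> (\<Sum>i\<in>(UNIV::'n set). \<mu>' n)" using \<mu>' by (intro sum_mono) auto
    then show "p \<le> CARD('n)" using \<open>0 < \<mu>' n\<close> by (simp add: p_def field_simps)
  qed
  have coarse: "torus_dist \<mu>' (torus_proj (F x)) (torus_proj (F y)) < L"
    if "0 \<le> snd x" "snd x \<le> real T" "snd y = snd x" "torus_dist \<mu> (torus_proj x) (torus_proj y) \<le> 1" for x y
  proof -
    have "torus_dist \<mu>' (torus_proj (F x)) (torus_proj (F y))
        \<le> \<kappa> * torus_dist \<mu> (torus_proj x) (torus_proj y) + c"
      using up[OF slabB slabB, of x y] that Fp by simp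
    also have "\<dots> \<le> \<kappa> * 1 + c" using that \<kappa> by (intro add_right_mono mult_left_mono) auto
    also have "\<dots> < L" by (simp add: L_def)
    finally show ?thesis .
  qed
  have line: "1 \<le> (\<Sum>j<grid_size \<mu> (snd q) i. w (q + ((real j / grid_size \<mu> (snd q) i) *\<^sub>R axis i 1, 0)))"
    if q: "0 \<le> snd q" "snd q \<le> real T" for q
  proof -
    have "1 \<le> (\<Sum>j<grid_size \<mu> (snd q) i. min 1 (2 * (L * exp (\<mu>' n *
        (L - snd (F (q + ((real j / grid_size \<mu> (snd q) i) *\<^sub>R axis i 1, 0))))))))"
      by (rule grid_line_weight_ge_1[OF \<mu>0 \<mu>0' F FW[OF _ _ ax] W[OF ax] i coarse q])
    also have "\<dots> \<le> (\<Sum>j<grid_size \<mu> (snd q) i. w (q + ((real j / grid_size \<mu> (snd q) i) *\<^sub>R axis i 1, 0)))"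
    proof (rule sum_mono)
      fix j
      let ?\<tau> = "snd (F (q + ((real j / grid_size \<mu> (snd q) i) *\<^sub>R axis i 1, 0)))"
      have "2 * (L * exp (\<mu>' n * (L - ?\<tau>))) = 2 * L * exp (\<mu>' n * L) * exp (- \<mu>' n * ?\<tau>)"
        by (simp add: algebra_simps flip: exp_add)
      also have "\<dots> \<le> E * exp (- \<mu>' n * ?\<tau>)"
        unfolding E_def using \<open>1 \<le> L\<close> \<mu>'(2) by (intro mult_right_mono mult_left_mono) auto
      finally show "min 1 (2 * (L * exp (\<mu>' n * (L - ?\<tau>))))
          \<le> w (q + ((real j / grid_size \<mu> (snd q) i) *\<^sub>R axis i 1, 0))"
        unfolding w_def by (rule min.mono[OF order_refl])
    qed
    finally show ?thesis .
  qed
  define S where "S = (SIGMA t:{..T}. cells (grid_size \<mu> (real t)))"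
  define g where "g \<sigma> = grid_point \<mu> (real (fst \<sigma>)) (snd \<sigma>)" for \<sigma>
  have g: "0 \<le> snd (g \<sigma>)" "snd (g \<sigma>) \<le> T" if "\<sigma> \<in> S" for \<sigma>
    using that by (auto simp: S_def g_def grid_point_def)
  have "finite S" unfolding S_def by (intro finite_SigmaI finite_cells) auto
  have "(\<Sum>t\<le>T. exp ((h - p * \<mu> n) * real t))
      \<le> (\<Sum>t\<le>T. 2 ^ CARD('n) * (\<Sum>k\<in>cells (grid_size \<mu> (real t)). w (grid_point \<mu> (real t) k) powr p))"
  proof (rule sum_mono)
    fix t assume "t \<in> {..T}"
    then show "exp ((h - p * \<mu> n) * real t)
        \<le> 2 ^ CARD('n) * (\<Sum>k\<in>cells (grid_size \<mu> (real t)). w (grid_point \<mu> (real t) k) powr p)"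
      unfolding h_def using \<mu> \<mu>0 p w0 line
      by (intro slice_sum_lower_bound[where i = i]) auto
  qed
  also have "\<dots> = 2 ^ CARD('n) * (\<Sum>\<sigma>\<in>S. w (g \<sigma>) powr p)"
  proof -
    have "(\<Sum>t\<le>T. \<Sum>k\<in>cells (grid_size \<mu> (real t)). w (grid_point \<mu> (real t) k) powr p)
        = (\<Sum>\<sigma>\<in>S. w (g \<sigma>) powr p)"
      unfolding S_def g_def by (subst sum.Sigma) (auto simp: finite_cells split_def)
    then show ?thesis by (simp flip: sum_distrib_left)
  qed
  also have "(\<Sum>\<sigma>\<in>S. w (g \<sigma>) powr p) \<le> (2 * (\<kappa> * R + c) + 2) * (M * (2 * E) ^ CARD('n))"
    unfolding w_def
  proof (rule weight_sum_upper_bound[OF \<mu>'(1) \<open>1 \<le> E\<close> _ _ p_def[THEN meta_eq_to_obj_eq] \<open>finite S\<close>])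
    show "0 \<le> M" using \<open>1 \<le> L2\<close> by (simp add: M_def)
    show "0 \<le> \<kappa> * R + c" using \<kappa> \<open>0 < R\<close> by simp
  next
    fix \<sigma> assume "\<sigma> \<in> S"
    have pB: "torus_proj (g \<sigma>) \<in> B" by (rule slabB[OF g[OF \<open>\<sigma> \<in> S\<close>]])
    \<comment> \<open>The base points bound the heights that the image of the ball can reach.\<close>
    have "\<bar>snd (F (g \<sigma>))\<bar> = \<bar>snd (f (torus_proj (g \<sigma>))) - snd (origin :: 'n torus \<times> real)\<bar>"
      using Fp[OF g[OF \<open>\<sigma> \<in> S\<close>]] by (metis diff_zero origin_def snd_torus_proj snd_zero)
    also have "\<dots> \<le> torus_dist \<mu>' (f origin) (f (torus_proj (g \<sigma>)))"
      unfolding f0 by (rule abs_height_diff_le_torus_dist[OF \<mu>0'])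
    also have "\<dots> \<le> \<kappa> * torus_dist \<mu> origin (torus_proj (g \<sigma>)) + c"
    proof (rule up[OF _ pB])
      show "origin \<in> B" using \<open>0 < R\<close> torus_dist_self[OF \<mu>0] by (simp add: B)
    qed
    also have "\<dots> \<le> \<kappa> * R + c" using pB \<kappa> by (simp add: B)
    finally show "\<bar>snd (F (g \<sigma>))\<bar> \<le> \<kappa> * R + c" .
  next
    fix \<sigma> assume \<sigma>: "\<sigma> \<in> S"
    let ?A = "{(t, k). t \<le> T \<and> k \<in> cells (grid_size \<mu> (real t)) \<and>
        torus_dist \<mu> (torus_proj (grid_point \<mu> (real t) k)) (torus_proj (g \<sigma>)) < L2}"
    have "{\<tau> \<in> S. box_index \<mu>' (F (g \<tau>)) = box_index \<mu>' (F (g \<sigma>))} \<subseteq> ?A"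
    proof clarify
      fix t k assume \<tau>: "(t, k) \<in> S" and eq: "box_index \<mu>' (F (g (t, k))) = box_index \<mu>' (F (g \<sigma>))"
      let ?d = "torus_dist \<mu> (torus_proj (g (t, k))) (torus_proj (g \<sigma>))"
      have "1 / \<kappa> * (?d - c) \<le> torus_dist \<mu>' (torus_proj (F (g (t, k)))) (torus_proj (F (g \<sigma>)))"
        using low[OF slabB[OF g[OF \<tau>]] slabB[OF g[OF \<sigma>]]] Fp g \<sigma> \<tau> by simp
      also have "\<dots> \<le> D0" unfolding D0_def by (rule same_box_close[OF \<mu>a' eq])
      finally have "?d \<le> D0 * \<kappa> + 1 * c" using \<kappa> by (simp add: field_simps)
      also have "\<dots> \<le> D0 * \<kappa> + D0 * c" using \<open>1 \<le> D0\<close> \<kappa> by (intro add_left_mono mult_right_mono) auto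
      also have "\<dots> < L2" by (simp add: \<open>L2 = _\<close> distrib_left)
      finally show "t \<le> T \<and> k \<in> cells (grid_size \<mu> (real t)) \<and>
          torus_dist \<mu> (torus_proj (grid_point \<mu> (real t) k)) (torus_proj (g \<sigma>)) < L2"
        using \<tau> by (auto simp: S_def g_def)
    qed
    moreover have "finite ?A"
      by (rule finite_subset[OF _ \<open>finite S\<close>]) (auto simp: S_def)
    ultimately have "real (card {\<tau> \<in> S. box_index \<mu>' (F (g \<tau>)) = box_index \<mu>' (F (g \<sigma>))}) \<le> real (card ?A)"
      by (intro of_nat_mono card_mono)
    also have "\<dots> \<le> M" unfolding M_def
      using card_close_grid_points[OF \<mu>a, of L2 T "g \<sigma>"] \<open>1 \<le> L2\<close> by simp
    finally show "real (card {\<tau> \<in> S. box_index \<mu>' (F (g \<tau>)) = box_index \<mu>' (F (g \<sigma>))}) \<le> M" .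
  qed
  finally show ?thesis by (simp add: M_def E_def mult.assoc)
qed

lemma polynomial_exponential_bound:
  fixes a L y :: real
  assumes "0 \<le> a" "1 \<le> L" "L \<le> y"
  shows "2 ^ n * (4 * L * ((2 * y + 1) * (4 * y * exp (a * y) + 1) ^ n * (2 * (2 * L * exp (a * L))) ^ n))
    \<le> 12 * 40 ^ n * exp ((2 + 2 * real n * (1 + a)) * y)"
proof -
  have y: "1 \<le> y" "y \<le> exp y" using assms exp_ge_add_one_self[of y] by linarith+
  have A: "y * exp (a * y) \<le> exp ((1 + a) * y)"
    using y by (simp add: distrib_right exp_add)
  have "exp (0::real) \<le> exp ((1 + a) * y)" using assms y by (subst exp_le_cancel_iff) simp
  then have 1: "4 * y * exp (a * y) + 1 \<le> 5 * exp ((1 + a) * y)" using A by (simp only: mult.assoc exp_zero)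
  have "L * exp (a * L) \<le> y * exp (a * y)" using assms by (intro mult_mono) (auto intro: mult_left_mono)
  then have 2: "2 * (2 * L * exp (a * L)) \<le> 4 * exp ((1 + a) * y)" using A by simp
  have "2 ^ n * (4 * L * ((2 * y + 1) * (4 * y * exp (a * y) + 1) ^ n * (2 * (2 * L * exp (a * L))) ^ n))
    \<le> 2 ^ n * (4 * exp y * (3 * exp y * (5 * exp ((1 + a) * y)) ^ n * (4 * exp ((1 + a) * y)) ^ n))"
    using assms y by (intro mult_left_mono mult_mono power_mono 1 2) (auto intro!: mult_nonneg_nonneg add_nonneg_nonneg)
  also have "\<dots> = 12 * (2 ^ n * 5 ^ n * 4 ^ n) * (exp y * exp y * (exp ((1 + a) * y) ^ n * exp ((1 + a) * y) ^ n))"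
    by (simp add: power_mult_distrib mult_ac)
  also have "2 ^ n * 5 ^ n * 4 ^ n = (40::real) ^ n" by (simp flip: power_mult_distrib)
  also have "exp y * exp y * (exp ((1 + a) * y) ^ n * exp ((1 + a) * y) ^ n)
      = exp ((2 + 2 * real n * (1 + a)) * y)"
    by (simp add: algebra_simps flip: exp_add exp_of_nat_mult)
  finally show ?thesis .
qed

theorem theorem5:
  fixes a b :: real
  assumes "0 < b" and "b \<le> a"
  shows "\<exists>G1 G2 :: real. G1 > 0 \<and>
    (\<forall>(\<mu> :: 'n::{finite,linorder} \<Rightarrow> real) (\<mu>' :: 'n \<Rightarrow> real) R :: real.
       mono \<mu> \<longrightarrow> mono \<mu>' \<longrightarrow>
       (\<forall>i. 0 < \<mu> i \<and> 0 < \<mu>' i) \<longrightarrow>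
       (\<forall>i. b \<le> \<mu> i \<and> \<mu> i \<le> a \<and> b \<le> \<mu>' i \<and> \<mu>' i \<le> a) \<longrightarrow>
       (\<Sum>i\<in>UNIV. \<mu> i) / \<mu> (Max UNIV) > (\<Sum>i\<in>UNIV. \<mu>' i) / \<mu>' (Max UNIV) \<longrightarrow>
       R > 0 \<longrightarrow>
       homotopy_qi_distortion UNIV (torus_dist \<mu>) origin UNIV (torus_dist \<mu>') origin R
         \<ge> ereal (min
             (G1 * ((\<Sum>i\<in>UNIV. \<mu> i) / \<mu> (Max UNIV) - (\<Sum>i\<in>UNIV. \<mu>' i) / \<mu>' (Max UNIV)) * R - G2)
             (R / 8)))"
proof -
  \<comment> \<open>\<open>D0\<close> bounds the diameter of a unit box, \<open>K\<close> and \<open>C0\<close> come from \<open>polynomial_exponential_bound\<close>; the second term of \<open>G2\<close> covers the radii below \<open>2 * n + 4\<close>.\<close>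
  define n where "n = real CARD('n)"
  define D0 where "D0 = 1 + n * exp a"
  define K where "K = 2 + 2 * n * (1 + a)"
  define C0 where "C0 = ln (12 * 40 ^ CARD('n)) + K"
  define G1 where "G1 = b / (4 * (K * D0))"
  define G2 where "G2 = C0 / (K * D0) + G1 * (n * (2 * n + 4))"
  have "0 < a" "1 \<le> n" using assms by (auto simp: n_def Suc_le_eq)
  have "1 \<le> D0" "0 < K" using \<open>0 < a\<close> \<open>1 \<le> n\<close> by (auto simp: D0_def K_def intro!: add_pos_nonneg)
  then have KD: "0 < K * D0" by simp
  then have "0 < G1" using assms by (simp add: G1_def)
  have "1 \<le> (40::real) ^ CARD('n)" by (rule one_le_power) simp
  then have "0 \<le> ln (12 * (40::real) ^ CARD('n))" by (intro ln_ge_zero) linarith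
  then have "0 \<le> C0" using \<open>0 < K\<close> by (simp add: C0_def)
  have main: "G1 * (h / \<mu> m - h' / \<mu>' m) * R - G2 \<le> \<kappa> + c"
    if mono: "mono \<mu>" "mono \<mu>'"
      and bd: "\<forall>i. b \<le> \<mu> i \<and> \<mu> i \<le> a \<and> b \<le> \<mu>' i \<and> \<mu>' i \<le> a"
      and h: "h = (\<Sum>i\<in>UNIV. \<mu> i)" "h' = (\<Sum>i\<in>UNIV. \<mu>' i)" and m: "m = Max UNIV"
      and gt: "h / \<mu> m > h' / \<mu>' m" and "R > 0"
      and qi: "quasi_isometric_embedding_on (Metric_space.mball UNIV (torus_dist \<mu>) origin R) (torus_dist \<mu>)
          UNIV (torus_dist \<mu>') \<kappa> c f"
      and f0: "f origin = origin"
      and heq: "homotopy_equivalence_map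
           (subtopology (torus_topology \<mu>) (Metric_space.mball UNIV (torus_dist \<mu>) origin R))
           (torus_topology \<mu>') f"
    for \<mu> \<mu>' :: "'n \<Rightarrow> real" and m h h' \<kappa> c f R
  proof -
    define \<delta> where "\<delta> = h / \<mu> m - h' / \<mu>' m"
    have "0 < \<delta>" using gt by (simp add: \<delta>_def)
    have \<kappa>: "0 < \<kappa>" "0 \<le> c" using qi by (auto simp: quasi_isometric_embedding_on_def)
    have "0 < \<mu> i" "0 < \<mu>' i" for i using bd[rule_format, of i] \<open>0 < b\<close> by linarith+
    moreover have "i \<le> m" for i by (simp add: m)
    ultimately have \<mu>: "\<forall>i. 0 < \<mu> i \<and> \<mu> i \<le> \<mu> m" and \<mu>': "\<forall>i. 0 < \<mu>' i \<and> \<mu>' i \<le> \<mu>' m"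
      using mono by (simp_all add: monoD)
    have "0 < \<mu> m" "0 < \<mu>' m" "b \<le> \<mu> m" "\<mu> m \<le> a" "\<mu>' m \<le> a" using \<mu> \<mu>' bd by blast+
    show ?thesis
    proof (cases "R < 2 * n + 4")
      case True
      have "h \<le> (\<Sum>i\<in>(UNIV::'n set). \<mu> m)" unfolding h using \<mu> by (intro sum_mono) auto
      then have "h / \<mu> m \<le> n" using \<open>0 < \<mu> m\<close> by (simp add: n_def field_simps)
      moreover have "0 \<le> h' / \<mu>' m"
        unfolding h using \<mu>' by (intro divide_nonneg_nonneg sum_nonneg) (auto intro: less_imp_le)
      ultimately have "\<delta> \<le> n" by (simp add: \<delta>_def)
      then have "G1 * (\<delta> * R) \<le> G1 * (n * (2 * n + 4))"
        using True \<open>0 < \<delta>\<close> \<open>0 < G1\<close> \<open>0 < R\<close> \<open>1 \<le> n\<close> by (intro mult_left_mono mult_mono) auto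
      moreover have "0 \<le> C0 / (K * D0)" using \<open>0 \<le> C0\<close> KD by simp
      ultimately show ?thesis
        using \<kappa> unfolding \<delta>_def[symmetric] by (simp add: G2_def mult.assoc)
    next
      case False
      \<comment> \<open>The slices up to height \<open>T\<close> lie in the ball, and \<open>T \<ge> R / 2\<close>.\<close>
      define T where "T = nat \<lfloor>R - n - 1\<rfloor>"
      define L where "L = \<kappa> + c + 1"
      define y where "y = D0 * (\<kappa> + c) + 1"
      have T: "T + n < R" "R / 2 \<le> real T"
        using False \<open>1 \<le> n\<close> unfolding T_def by linarith+
      have "1 \<le> L" using \<kappa> by (simp add: L_def)
      have "L \<le> y" using \<kappa> \<open>1 \<le> D0\<close> mult_right_mono[of 1 D0 "\<kappa> + c"] by (simp add: L_def y_def)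
      let ?x = "h - h' / \<mu>' m * \<mu> m"
      let ?Q = "(2 * y + 1) * (4 * y * exp (a * y) + 1) ^ CARD('n) * (2 * (2 * L * exp (a * L))) ^ CARD('n)"
      have "0 \<le> ?Q" using \<open>1 \<le> L\<close> \<open>L \<le> y\<close> by auto
      have x: "?x = \<mu> m * \<delta>" using \<open>0 < \<mu> m\<close> by (simp add: \<delta>_def right_diff_distrib)
      have "R / 2 * exp (b * \<delta> * R / 4) \<le> (real T + 1) * exp (?x * T / 2)"
      proof (rule mult_mono)
        have "b * \<delta> * (R / 2) \<le> ?x * T"
          unfolding x using \<open>b \<le> \<mu> m\<close> \<open>0 < \<delta>\<close> T \<open>0 < b\<close> \<open>0 < R\<close> \<open>0 < \<mu> m\<close>
          by (intro mult_mono) auto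
        then have "b * \<delta> * (R / 2) / 2 \<le> ?x * T / 2" by (rule divide_right_mono) simp
        then have "b * \<delta> * R / 4 \<le> ?x * T / 2" by simp
        then show "exp (b * \<delta> * R / 4) \<le> exp (?x * T / 2)" by (subst exp_le_cancel_iff)
      qed (use T in auto)
      also have "\<dots> \<le> (\<Sum>t\<le>T. exp (?x * real t))" by (rule exp_sum_ge_midpoint)
      also have "\<dots> \<le> 2 ^ CARD('n) * ((2 * (\<kappa> * R + c) + 2) * ?Q)"
        using embedding_exponential_sum_bound[OF \<mu> \<open>\<mu> m \<le> a\<close> \<mu>' \<open>\<mu>' m \<le> a\<close> qi f0 heq, of T] T
        by (simp add: h y_def D0_def L_def n_def)
      also have "\<dots> \<le> 2 ^ CARD('n) * ((2 * R * L) * ?Q)"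
      proof (intro mult_left_mono mult_right_mono \<open>0 \<le> ?Q\<close>)
        have "c \<le> c * R" "1 \<le> R" using False \<open>1 \<le> n\<close> \<kappa> by (auto intro: mult_left_mono[of 1 R c, simplified])
        then show "2 * (\<kappa> * R + c) + 2 \<le> 2 * R * L" by (simp add: L_def algebra_simps)
      qed auto
      also have "\<dots> = R / 2 * (2 ^ CARD('n) * (4 * L * ?Q))" by simp
      finally have "exp (b * \<delta> * R / 4) \<le> 2 ^ CARD('n) * (4 * L * ?Q)"
        using \<open>0 < R\<close> by (subst (asm) mult_le_cancel_left_pos) auto
      also have "\<dots> \<le> 12 * 40 ^ CARD('n) * exp (K * y)"
        using polynomial_exponential_bound[OF _ \<open>1 \<le> L\<close> \<open>L \<le> y\<close>, of a "CARD('n)"] \<open>0 < a\<close>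
        by (simp add: K_def n_def)
      finally have "exp (b * \<delta> * R / 4) \<le> exp (ln (12 * 40 ^ CARD('n)) + K * y)"
        by (simp add: exp_add)
      then have "b * \<delta> * R / 4 \<le> C0 + K * D0 * (\<kappa> + c)"
        by (simp add: C0_def y_def algebra_simps)
      then have "b * \<delta> * R / 4 / (K * D0) \<le> (C0 + K * D0 * (\<kappa> + c)) / (K * D0)"
        using KD by (intro divide_right_mono) auto
      also have "\<dots> = C0 / (K * D0) + (\<kappa> + c)" using \<open>0 < K\<close> \<open>1 \<le> D0\<close> by (simp add: add_divide_distrib)
      finally have "G1 * \<delta> * R \<le> C0 / (K * D0) + (\<kappa> + c)" by (simp add: G1_def mult_ac)
      moreover have "0 \<le> G1 * (n * (2 * n + 4))" using \<open>0 < G1\<close> \<open>1 \<le> n\<close> by simp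
      ultimately show ?thesis unfolding \<delta>_def[symmetric] by (simp add: G2_def)
    qed
  qed
  show ?thesis
  proof (rule exI[of _ G1], rule exI[of _ G2], intro conjI allI impI \<open>0 < G1\<close>)
    fix \<mu> \<mu>' :: "'n \<Rightarrow> real" and R :: real
    assume "\<forall>i. 0 < \<mu> i \<and> 0 < \<mu>' i"
      and *: "mono \<mu>" "mono \<mu>'" "\<forall>i. b \<le> \<mu> i \<and> \<mu> i \<le> a \<and> b \<le> \<mu>' i \<and> \<mu>' i \<le> a"
      "(\<Sum>i\<in>UNIV. \<mu> i) / \<mu> (Max UNIV) > (\<Sum>i\<in>UNIV. \<mu>' i) / \<mu>' (Max UNIV)" "R > 0"
    show "homotopy_qi_distortion UNIV (torus_dist \<mu>) origin UNIV (torus_dist \<mu>') origin R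
         \<ge> ereal (min
             (G1 * ((\<Sum>i\<in>UNIV. \<mu> i) / \<mu> (Max UNIV) - (\<Sum>i\<in>UNIV. \<mu>' i) / \<mu>' (Max UNIV)) * R - G2)
             (R / 8))"
      unfolding homotopy_qi_distortion_def
    proof (rule Inf_greatest, clarify)
      fix \<kappa> c f
      assume "quasi_isometric_embedding_on (Metric_space.mball UNIV (torus_dist \<mu>) origin R) (torus_dist \<mu>)
          UNIV (torus_dist \<mu>') \<kappa> c f" "f origin = origin"
        "homotopy_equivalence_map
           (subtopology (torus_topology \<mu>) (Metric_space.mball UNIV (torus_dist \<mu>) origin R))
           (torus_topology \<mu>') f"
      from main[OF *(1-3) refl refl refl *(4,5) this]
      show "ereal (min
             (G1 * ((\<Sum>i\<in>UNIV. \<mu> i) / \<mu> (Max UNIV) - (\<Sum>i\<in>UNIV. \<mu>' i) / \<mu>' (Max UNIV)) * R - G2)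
             (R / 8)) \<le> ereal (\<kappa> + c)" by (simp add: min_le_iff_disj)
    qed
  qed
qed

end
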